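(* Let $d\in\mathbb{N}$, $\beta\ge 1$, $\ell$ the largest integer strictly smaller than $\beta$, $L_0,\dots,L_\ell,L_\beta>0$, $C_{\mathsf{noise}},C_{\mathsf{cvr}}>0$, and $p\in[1,\infty)$. There is a constant $C>0$ large enough, depending only on $\beta,d,L_0,\dots,L_\ell,L_\beta,C_{\mathsf{noise}},C_{\mathsf{cvr}},p$, with the following property. Consider the ODE observation model described in the context, with noise distribution $P^\varepsilon$ satisfying (Noise) with constant $C_{\mathsf{noise}}$ and initial conditions $x_1,\dots,x_m$ satisfying (Cover) with constant $C_{\mathsf{cvr}}$. Assume $$m^{\frac{2\beta}{d}}\ge C\, n_{\mathsf{max}} T_{\mathsf{max}}^2\qquad\text{and}\qquad m\, n_{\mathsf{max}} T_{\mathsf{max}}^2\ge C.$$ Then $$\forall x_0\in[0,1]^d:\ \inf_{\hat f}\sup_{f^\star\in\mathcal{F}_{d,\beta}}\mathbf{P}_{f^\star}\Big(C\,\|\hat f(x_0)-f^\star(x_0)\|_2\ge (m\,n_{\mathsf{max}}T_{\mathsf{max}}^2)^{-\frac{\beta}{2\beta+d}}\Big)\ge\tfrac14,$$ $$\inf_{\hat f}\sup_{f^\star\in\mathcal{F}_{d,\beta}}\mathbf{P}_{f^\star}\bigg(C\sup_{x\in[0,1]^d}\|\hat f(x)-f^\star(x)\|_2\ge \Big(\frac{m\,n_{\mathsf{max}}T_{\mathsf{max}}^2}{\log(m\,n_{\mathsf{max}}T_{\mathsf{max}}^2)}\Big)^{-\frac{\beta}{2\beta+d}}\bigg)\ge\tfrac14,$$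 $$\inf_{\hat f}\sup_{f^\star\in\mathcal{F}_{d,\beta}}\mathbf{P}_{f^\star}\Big(C\,\big\|\,\|\hat f-f^\star\|_2\,\big\|_{L^p([0,1]^d)}\ge (m\,n_{\mathsf{max}}T_{\mathsf{max}}^2)^{-\frac{\beta}{2\beta+d}}\Big)\ge\tfrac14,$$ where the infima range over all estimators $\hat f$ of $f^\star$ based on the observations $(Y_{j,i})$.
   Context: Smoothness class: $\mathcal{F}_{d,\beta}$ is the set of functions $f=(f_1,\dots,f_d):\mathbb{R}^d\to\mathbb{R}^d$ such that each component $f_j$ is $\ell$ times differentiable, $\sup_x\|D^kf_j(x)\|_{\mathsf{op}}\le L_k$ for $k=0,\dots,\ell$, and $\|D^\ell f_j(x)-D^\ell f_j(\tilde x)\|_{\mathsf{op}}\le L_\beta\|x-\tilde x\|_2^{\beta-\ell}$ for all $x,\tilde x\in\mathbb{R}^d$. Here $D^k f_j(x)$ is the $k$-th derivative as a symmetric $k$-linear form and $\|A\|_{\mathsf{op}}=\sup\{|A(v_1,\dots,v_k)|:\|v_i\|_2=1\}$; $\|\cdot\|_2$ is the Euclidean norm. Functions in this class are globally Lipschitz since $\beta\geq1$. Flow: for Lipschitz $f:\mathbb{R}^d\to\mathbb{R}^d$ and $x\in\mathbb{R}^d$, $t\mapsto U(f,x,t)$, $t\in\mathbb{R}$, is the solution of $\dot u(t)=f(u(t))$, $u(0)=x$. Observation model: $m\in\mathbb{N}$ trajectories; $n_1,\dots,n_m\in\mathbb{N}$ observations per trajectory, $n_{\mathsf{max}}=\max_j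 n_j$; durations $T_1,\dots,T_m>0$, $T_{\mathsf{max}}=\max_jT_j$; known observation times $0=t_{j,0}\le t_{j,1}\le\dots\le t_{j,n_j}=T_j$; known initial conditions $x_1,\dots,x_m\in\mathbb{R}^d$. One observes $$Y_{j,i}=U(f^\star,x_j,t_{j,i})+\varepsilon_{j,i},\qquad j\in\{1,\dots,m\},\ i\in\{1,\dots,n_j\},$$ with $f^\star\in\mathcal{F}_{d,\beta}$ unknown and $\varepsilon_{j,i}$ i.i.d. centered $\mathbb{R}^d$-valued with distribution $P^\varepsilon$. $\mathbf{P}_{f^\star}$ is the corresponding probability measure. (Noise): for all $v_1,v_2\in\mathbb{R}^d$, $\mathrm{KL}(v_1+P^\varepsilon,v_2+P^\varepsilon)\le C_{\mathsf{noise}}\|v_1-v_2\|_2^2$, where $\mathrm{KL}$ is the Kullback–Leibler divergence and $v+P$ is the distribution $P$ shifted by $v$. (Cover): for all $z\in[0,1]^d$ and $r>0$, $\frac1m\#\{j\in\{1,\dots,m\}:\|x_j-z\|_2<r\}\le\max(\frac1m,C_{\mathsf{cvr}}r^d)$. *)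

theory Defs
  imports "HOL-Probability.Probability"
begin

section \<open>Smoothness class\<close>

text \<open>
  \<open>deriv_form g [v\<^sub>1, \<dots>, v\<^sub>k] x\<close> is the \<open>k\<close>-th Frechet derivative of \<open>g\<close> at \<open>x\<close>, evaluated as a
  \<open>k\<close>-linear form: \<open>D\<^sup>k g(x)(v\<^sub>1, \<dots>, v\<^sub>k)\<close>. As the space of \<open>k\<close>-linear forms on a Euclidean space
  is finite-dimensional, \<open>x \<mapsto> D\<^sup>k g(x)\<close> is Frechet differentiable iff all its evaluations are, and
  the derivative is then computed evaluation-wise.
\<close>

primrec deriv_form :: "('a::euclidean_space \<Rightarrow> real) \<Rightarrow> 'a list \<Rightarrow> 'a \<Rightarrow> real" where
  "deriv_form g [] = g"
| "deriv_form g (v # vs) = (\<lambda>x. frechet_derivative (deriv_form g vs) (at x) v)"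

definition times_differentiable :: "nat \<Rightarrow> ('a::euclidean_space \<Rightarrow> real) \<Rightarrow> bool" where
  "times_differentiable k g \<longleftrightarrow>
     (\<forall>vs. length vs < k \<longrightarrow> (\<forall>x. deriv_form g vs differentiable (at x)))"

text \<open>
  The supremum is over a nonempty set (a Euclidean space has unit vectors), which is bounded for
  every \<open>k\<close>-linear form.
\<close>

definition form_op_norm :: "nat \<Rightarrow> ('a::euclidean_space list \<Rightarrow> real) \<Rightarrow> real" where
  "form_op_norm k A = (SUP vs\<in>{vs. length vs = k \<and> (\<forall>v\<in>set vs. norm v = 1)}. \<bar>A vs\<bar>)"

definition smoothness_order :: "real \<Rightarrow> nat" where
  "smoothness_order \<beta> = (GREATEST k. real k < \<beta>)"

definition smooth_class ::
    "real \<Rightarrow> (nat \<Rightarrow> real) \<Rightarrow> real \<Rightarrow> (real^'d::finite \<Rightarrow> real^'d) set" where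
  "smooth_class \<beta> L L\<^sub>\<beta> = {f. \<forall>j. let f\<^sub>j = (\<lambda>x. f x $ j); l = smoothness_order \<beta> in
     times_differentiable l f\<^sub>j \<and>
     (\<forall>k\<le>l. \<forall>x. form_op_norm k (\<lambda>vs. deriv_form f\<^sub>j vs x) \<le> L k) \<and>
     (\<forall>x x'. form_op_norm l (\<lambda>vs. deriv_form f\<^sub>j vs x - deriv_form f\<^sub>j vs x')
               \<le> L\<^sub>\<beta> * norm (x - x') powr (\<beta> - real l))}"

section \<open>Observation model\<close>

definition flow :: "('a::euclidean_space \<Rightarrow> 'a) \<Rightarrow> 'a \<Rightarrow> real \<Rightarrow> 'a" where
  "flow f x = (THE u. u 0 = x \<and> (\<forall>t. (u has_vector_derivative f (u t)) (at t)))"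

definition observation_design ::
    "nat \<Rightarrow> (nat \<Rightarrow> nat) \<Rightarrow> (nat \<Rightarrow> real) \<Rightarrow> (nat \<Rightarrow> nat \<Rightarrow> real) \<Rightarrow> bool" where
  "observation_design m n T t \<longleftrightarrow> 1 \<le> m \<and>
     (\<forall>j\<in>{1..m}. 1 \<le> n j \<and> 0 < T j \<and> t j 0 = 0 \<and>
        (\<forall>i<n j. t j i \<le> t j (Suc i)) \<and> t j (n j) = T j)"

definition obs_index :: "nat \<Rightarrow> (nat \<Rightarrow> nat) \<Rightarrow> (nat \<times> nat) set" where
  "obs_index m n = (SIGMA j:{1..m}. {1..n j})"

definition obs_space ::
    "nat \<Rightarrow> (nat \<Rightarrow> nat) \<Rightarrow> (nat \<times> nat \<Rightarrow> 'a::euclidean_space) measure" where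
  "obs_space m n = (\<Pi>\<^sub>M ji\<in>obs_index m n. borel)"

definition centered_distribution :: "'a::euclidean_space measure \<Rightarrow> bool" where
  "centered_distribution P \<longleftrightarrow> prob_space P \<and> sets P = sets borel \<and>
     integrable P (\<lambda>e. e) \<and> (\<integral>e. e \<partial>P) = 0"

text \<open>
  The law of the data \<open>Y\<^sub>j\<^sub>,\<^sub>i = U(f, x\<^sub>j, t\<^sub>j\<^sub>,\<^sub>i) + \<epsilon>\<^sub>j\<^sub>,\<^sub>i\<close>, where the noise family
  \<open>\<epsilon>\<close> has the product distribution with all marginals equal to \<open>P\<close>.
\<close>

definition obs_law ::
    "nat \<Rightarrow> (nat \<Rightarrow> nat) \<Rightarrow> (nat \<Rightarrow> nat \<Rightarrow> real) \<Rightarrow> (nat \<Rightarrow> 'a) \<Rightarrow> 'a measure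
     \<Rightarrow> ('a \<Rightarrow> 'a) \<Rightarrow> (nat \<times> nat \<Rightarrow> 'a::euclidean_space) measure" where
  "obs_law m n t x P f =
     distr (\<Pi>\<^sub>M ji\<in>obs_index m n. P) (obs_space m n)
       (\<lambda>\<epsilon>. \<lambda>(j, i)\<in>obs_index m n. flow f (x j) (t j i) + \<epsilon> (j, i))"

text \<open>
  The Kullback--Leibler divergence of \<open>P\<close> from \<open>Q\<close>, for probability measures. The constant
  \<^const>\<open>KL_divergence\<close> takes its arguments in the opposite order and is meaningful
  only if \<open>P\<close> is absolutely continuous with respect to \<open>Q\<close> and the log-density is \<open>P\<close>-integrable;
  in all other cases the divergence is infinite.
\<close>

definition KL :: "'a measure \<Rightarrow> 'a measure \<Rightarrow> ereal" where
  "KL P Q = (if absolutely_continuous Q P \<and> integrable P (entropy_density (exp 1) Q P)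
             then ereal (KL_divergence (exp 1) Q P) else \<infinity>)"

definition shift_measure :: "'a::euclidean_space \<Rightarrow> 'a measure \<Rightarrow> 'a measure" where
  "shift_measure v P = distr P borel (\<lambda>e. v + e)"

definition noise_condition :: "real \<Rightarrow> 'a::euclidean_space measure \<Rightarrow> bool" where
  "noise_condition c P \<longleftrightarrow>
     (\<forall>v\<^sub>1 v\<^sub>2. KL (shift_measure v\<^sub>1 P) (shift_measure v\<^sub>2 P) \<le> ereal (c * (norm (v\<^sub>1 - v\<^sub>2))\<^sup>2))"

definition unit_cube :: "(real^'d::finite) set" where
  "unit_cube = {z. \<forall>i. 0 \<le> z $ i \<and> z $ i \<le> 1}"

definition cover_condition :: "real \<Rightarrow> nat \<Rightarrow> (nat \<Rightarrow> real^'d::finite) \<Rightarrow> bool" where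
  "cover_condition c m x \<longleftrightarrow>
     (\<forall>z\<in>unit_cube. \<forall>r>0.
        real (card {j\<in>{1..m}. norm (x j - z) < r}) / real m \<le> max (1 / real m) (c * r ^ CARD('d)))"

section \<open>Estimators and minimax probabilities\<close>

text \<open>
  An estimator maps the data to a Borel vector field such that each of its values is a random
  vector. The design (initial conditions, observation times) is known, so an estimator may depend
  on it arbitrarily.
\<close>

definition estimators ::
    "nat \<Rightarrow> (nat \<Rightarrow> nat) \<Rightarrow> ((nat \<times> nat \<Rightarrow> 'a) \<Rightarrow> 'a \<Rightarrow> 'a::euclidean_space) set" where
  "estimators m n = {fh.
     (\<forall>z. (\<lambda>y. fh y z) \<in> borel_measurable (obs_space m n)) \<and>
     (\<forall>y\<in>space (obs_space m n). fh y \<in> borel_measurable borel)}"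

text \<open>
  \<open>minimax_prob m n t x P F E\<close> is the infimum over estimators \<open>fh\<close> of the supremum over \<open>f \<in> F\<close> of
  the probability, under \<open>f\<close>, of the event \<open>E (fh Y) f\<close>. This event is an uncountable
  union for the uniform loss and need not be measurable; the outer measure
  is the probability whenever the event is measurable.
\<close>

definition minimax_prob ::
    "nat \<Rightarrow> (nat \<Rightarrow> nat) \<Rightarrow> (nat \<Rightarrow> nat \<Rightarrow> real) \<Rightarrow> (nat \<Rightarrow> 'a) \<Rightarrow> 'a measure
     \<Rightarrow> ('a \<Rightarrow> 'a) set \<Rightarrow> (('a \<Rightarrow> 'a) \<Rightarrow> ('a \<Rightarrow> 'a::euclidean_space) \<Rightarrow> bool) \<Rightarrow> ennreal" where
  "minimax_prob m n t x P F E =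
     (INF fh\<in>estimators m n. SUP f\<in>F.
        outer_measure_of (obs_law m n t x P f) {y\<in>space (obs_space m n). E (fh y) f})"

definition sup_loss :: "(real^'d::finite \<Rightarrow> real^'d) \<Rightarrow> (real^'d \<Rightarrow> real^'d) \<Rightarrow> ennreal" where
  "sup_loss g f = (SUP z\<in>unit_cube. ennreal (norm (g z - f z)))"

definition lp_norm_cube :: "real \<Rightarrow> (real^'d::finite \<Rightarrow> real) \<Rightarrow> ennreal" where
  "lp_norm_cube p h =
     (let I = (\<integral>\<^sup>+z\<in>unit_cube. ennreal (\<bar>h z\<bar> powr p) \<partial>lborel)
      in if I = \<infinity> then \<infinity> else ennreal (enn2real I powr (1 / p)))"

end

theory Submission
  imports Defs "HOL-Computational_Algebra.Polynomial"
begin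

text \<open>
  The hypotheses are vector fields \<open>f\<^sub>\<theta> = A (\<Sum>\<kappa>. \<theta>\<^sub>\<kappa> \<Prod>\<^sub>i \<psi> ((x\<^sub>i - z\<^sub>\<kappa>\<^sub>i) / h)) e\<close> with a
  constant direction \<open>e\<close>, height \<open>A = a h\<^sup>\<beta>\<close>, disjoint bumps of width \<open>h\<close> and
  \<open>\<theta>\<^sub>\<kappa> \<in> [0, 1]\<close>. They are compared to the zero field, whose trajectories are constant. A
  trajectory of \<open>f\<^sub>\<theta>\<close> moves only if it starts in the support, and then by at most \<open>A T\<close>, so
  by (Cover) each bump contributes at most
  \<open>C\<^sub>n\<^sub>o\<^sub>i\<^sub>s\<^sub>e max(1, C m h\<^sup>d) n T\<^sup>2 A\<^sup>2\<close> to the Kullback--Leibler divergence. This is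
  bounded for \<open>h \<approx> N powr (-1 / (2 \<beta> + d))\<close>, and of order \<open>ln N\<close> if \<open>N\<close> is replaced by
  \<open>N / ln N\<close>.

  All three bounds then follow from one inequality of Fano type, derived from the
  Donsker--Varadhan inequality \<open>\<integral> g dP \<le> KL(P, Q) + ln \<integral> exp g dQ\<close>. At a point, one bump with
  64 different heights is used; for the sup loss, a single bump at one of the \<open>h\<^sup>-\<^sup>d\<close> grid
  points; for the \<open>L\<^sup>p\<close> loss, which dominates the \<open>L\<^sup>1\<close> loss, all \<open>\<theta> \<in> {0, 1}\<^sup>M\<close>, where the
  \<open>L\<^sup>1\<close> distance is proportional to the Hamming distance and only an exponentially small part of
  the cube lies in a Hamming ball of radius \<open>M / 8\<close>.
\<close>

section \<open>The Donsker--Varadhan inequality and Fano's inequality\<close>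

text \<open>Comparing with the zero field keeps the time horizon harmless: against a constant
  trajectory, displacement is at most speed times time, whereas two nonzero fields would call for
  Gronwall's inequality and a factor exponential in T. One reference law suffices, as the Fano
  inequality uses only divergences to a fixed law.

  The divergence is used only through integrals of bounded test functions. This avoids densities of
  the product laws and a chain rule for \<open>KL\<close>, which is infinite by definition outside
  the class of integrable log-densities.

  Fano's inequality is phrased by counting the hypotheses that lie within the target accuracy of a
  fixed estimate, so no well separated subfamily of the cube (Varshamov-Gilbert) has to be
  extracted.

  The three families balance divergence and entropy differently: a constant against ln 64; order ln
  N against the logarithm of the number of grid points, whence the logarithm in the sup rate; order
  M against order M for the L^p loss. If all error probabilities were below 1/4, all success
  probabilities would exceed 3/4, and this contradicts divergence + 1 <= 3/4 ln (hypotheses /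
  count).\<close>

lemma KL_variational:
  assumes P: "prob_space P" and Q: "prob_space Q" and S: "sets P = sets Q"
    and kl: "KL P Q \<le> ereal k"
    and g[measurable]: "g \<in> borel_measurable Q" and B: "\<And>x. \<bar>g x\<bar> \<le> B"
  shows "(\<integral>x. g x \<partial>P) \<le> k + ln (\<integral>x. exp (g x) \<partial>Q)"
proof -
  interpret P: prob_space P by fact
  interpret Q: prob_space Q by fact
  have ac: "absolutely_continuous Q P" and int: "integrable P (entropy_density (exp 1) Q P)"
    and klk: "KL_divergence (exp 1) Q P \<le> k"
    using kl by (auto simp: KL_def split: if_splits)
  have [measurable_cong]: "sets P = sets Q" by fact
  define D where "D = (\<lambda>x. enn2real (RN_deriv Q P x))"
  define Z where "Z = (\<integral>x. exp (g x) \<partial>Q)"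
  have D[measurable]: "D \<in> borel_measurable Q" by (simp add: D_def)
  have D0: "D x \<ge> 0" for x by (simp add: D_def)
  have PD: "P = density Q (\<lambda>x. ennreal (D x))"
  proof -
    have "AE x in Q. RN_deriv Q P x \<noteq> \<infinity>"
      using Q.RN_deriv_finite[OF P.sigma_finite_measure_axioms ac S] by simp
    then have "density Q (RN_deriv Q P) = density Q (\<lambda>x. ennreal (D x))"
      by (intro density_cong) (auto simp: D_def top.not_eq_extremum)
    with Q.density_RN_deriv[OF ac S] show ?thesis by simp
  qed
  have ed: "entropy_density (exp 1) Q P = (\<lambda>x. ln (D x))"
    by (auto simp: entropy_density_def D_def log_def fun_eq_iff)
  have g_int: "integrable P g"
    by (intro P.integrable_const_bound[of _ B]) (use B in auto)
  have eg_int: "integrable Q (\<lambda>x. exp (g x))"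
    by (intro Q.integrable_const_bound[of _ "exp B"]) (use B in \<open>auto simp: abs_le_iff\<close>)
  have "exp (-B) \<le> Z" unfolding Z_def
    by (rule Q.integral_ge_const[OF eg_int]) (use B in \<open>auto simp: abs_le_iff minus_le_iff\<close>)
  then have Z: "Z > 0" by (smt (verit) exp_gt_zero)
  have de_int: "integrable Q (\<lambda>x. D x * exp (g x - ln (D x)))"
    and le: "(\<integral>x. D x * exp (g x - ln (D x)) \<partial>Q) \<le> Z"
  proof -
    \<comment> \<open>Equality holds where \<open>D x\<close> is positive. Where
      \<open>D x = 0\<close> the left side vanishes, whatever value \<open>ln\<close> takes at 0;
      this part of \<open>Q\<close>, not charged by \<open>P\<close>, is why only an inequality
      results.\<close>
    have *: "D x * exp (g x - ln (D x)) \<le> exp (g x)" for x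
      using D0[of x] by (cases "D x = 0") (auto simp: exp_diff)
    show i: "integrable Q (\<lambda>x. D x * exp (g x - ln (D x)))"
      by (rule Bochner_Integration.integrable_bound[OF eg_int]) (use * D0 in auto)
    show "(\<integral>x. D x * exp (g x - ln (D x)) \<partial>Q) \<le> Z"
      unfolding Z_def by (intro integral_mono i eg_int *)
  qed
  have e_int: "integrable P (\<lambda>x. exp (g x - ln (D x)))"
    unfolding PD by (subst integrable_real_density) (use D0 de_int in auto)
  have e_le: "(\<integral>x. exp (g x - ln (D x)) \<partial>P) \<le> Z"
    unfolding PD by (subst integral_real_density) (use D0 le in auto)
  have ln_int: "integrable P (\<lambda>x. ln (D x))" using int by (simp add: ed)
  have "(\<integral>x. g x \<partial>P) = (\<integral>x. ln (D x) \<partial>P) + (\<integral>x. g x - ln (D x) \<partial>P)"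
    using g_int ln_int by simp
  also have "(\<integral>x. ln (D x) \<partial>P) \<le> k" using klk by (simp add: KL_divergence_def ed)
  \<comment> \<open>Jensen's inequality in tangent form: y <= exp y / Z - 1 + ln Z is 1 + s <= exp s
    at s = y - ln Z.\<close>
  also have "(\<integral>x. g x - ln (D x) \<partial>P) \<le> (\<integral>x. exp (g x - ln (D x)) / Z - 1 + ln Z \<partial>P)"
  proof (intro integral_mono)
    show "g x - ln (D x) \<le> exp (g x - ln (D x)) / Z - 1 + ln Z" for x
      using exp_ge_add_one_self[of "g x - ln (D x) - ln Z"] Z by (simp add: exp_diff)
  qed (use g_int ln_int e_int in auto)
  also have "\<dots> = (\<integral>x. exp (g x - ln (D x)) \<partial>P) / Z - 1 + ln Z"
    using e_int by (simp add: P.prob_space)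
  also have "\<dots> \<le> ln Z" using e_le Z by (simp add: field_simps)
  finally show ?thesis by (simp add: Z_def)
qed

lemma noise_shift_variational:
  fixes P :: "'a::euclidean_space measure"
  assumes P: "prob_space P" and S: "sets P = sets borel" and nc: "noise_condition c P"
    and g[measurable]: "g \<in> borel_measurable borel" and B: "\<And>x. \<bar>g x\<bar> \<le> B"
  shows "(\<integral>e. g (v + e) \<partial>P) \<le> c * (norm (v - w))\<^sup>2 + ln (\<integral>e. exp (g (w + e)) \<partial>P)"
proof -
  interpret P: prob_space P by fact
  have [measurable_cong]: "sets P = sets borel" by fact
  have p: "prob_space (shift_measure u P)" for u
    unfolding shift_measure_def by (rule P.prob_space_distr) simp
  have "(\<integral>x. g x \<partial>shift_measure v P) \<le> c * (norm (v - w))\<^sup>2 + ln (\<integral>x. exp (g x) \<partial>shift_measure w P)"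
    by (rule KL_variational[OF p p, where B=B])
      (use nc B in \<open>auto simp: shift_measure_def noise_condition_def\<close>)
  then show ?thesis by (simp add: shift_measure_def integral_distr)
qed

text \<open>The variational inequality tensorizes by integrating out one coordinate at a time.\<close>

lemma product_shift_variational:
  fixes P :: "'a::euclidean_space measure" and v w :: "'i \<Rightarrow> 'a"
  assumes P: "prob_space P" and S: "sets P = sets borel" and nc: "noise_condition c P"
    and I: "finite I"
    and g: "g \<in> borel_measurable (\<Pi>\<^sub>M i\<in>I. borel)" and B: "\<And>x. \<bar>g x\<bar> \<le> B"
  shows "(\<integral>e. g (\<lambda>i\<in>I. v i + e i) \<partial>(\<Pi>\<^sub>M i\<in>I. P))
     \<le> (\<Sum>i\<in>I. c * (norm (v i - w i))\<^sup>2) + ln (\<integral>e. exp (g (\<lambda>i\<in>I. w i + e i)) \<partial>(\<Pi>\<^sub>M i\<in>I. P))"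
  using I g B
proof (induction I arbitrary: g B rule: finite_induct)
  case empty
  then show ?case by (simp add: PiM_empty lebesgue_integral_count_space_finite)
next
  case (insert i I)
  interpret P: prob_space P by fact
  interpret pp: product_prob_space "\<lambda>_::'i. P" UNIV by (simp add: P product_prob_spaceI)
  have [measurable_cong]: "sets P = sets borel" by fact
  note g[measurable] = insert.prems(1)
  note B = insert.prems(2)
  have pI: "prob_space (\<Pi>\<^sub>M i\<in>J. P)" for J :: "'i set" by (rule prob_space_PiM) (rule P)
  interpret PI: prob_space "\<Pi>\<^sub>M i\<in>I. P" by (rule pI)
  interpret PI': prob_space "\<Pi>\<^sub>M i\<in>insert i I. P" by (rule pI)
  have upd: "(\<lambda>k\<in>insert i I. u k + (e(i := y)) k) = (\<lambda>k\<in>I. u k + e k)(i := u i + y)"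
    for u e :: "'i \<Rightarrow> 'a" and y using insert.hyps by (auto simp: fun_eq_iff)
  \<comment> \<open>\<open>G\<close> is the log-moment generating function in coordinate
    \<open>i\<close> alone. As \<open>exp (G u)\<close> is the inner integral, feeding
    \<open>G\<close> to the induction hypothesis rebuilds the full exponential integral by
    Fubini.\<close>
  define G where "G u = ln (\<integral>y. exp (g (u(i := w i + y))) \<partial>P)" for u
  have sec[measurable]: "(\<lambda>y. g (u(i := y))) \<in> borel_measurable borel" if "u \<in> space (\<Pi>\<^sub>M i\<in>I. borel)" for u
  proof -
    have "(\<lambda>y. u(i := y)) \<in> borel \<rightarrow>\<^sub>M (\<Pi>\<^sub>M i\<in>insert i I. borel)"
      using that by (intro measurable_fun_upd[where J=I]) auto
    from measurable_compose[OF this g] show ?thesis .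
  qed
  have eB: "exp (-B) \<le> exp (g x)" "exp (g x) \<le> exp B" for x
    using B[of x] by (auto simp: abs_le_iff)
  have int_bd: "exp (-B) \<le> (\<integral>y. exp (g (u(i := w i + y))) \<partial>P)" "(\<integral>y. exp (g (u(i := w i + y))) \<partial>P) \<le> exp B"
    if u: "u \<in> space (\<Pi>\<^sub>M i\<in>I. borel)" for u
  proof -
    have m: "(\<lambda>y. g (u(i := w i + y))) \<in> borel_measurable borel"
      using measurable_compose[OF _ sec[OF u], of "\<lambda>y. w i + y" borel] by simp
    have *: "integrable P (\<lambda>y. exp (g (u(i := w i + y))))"
      by (intro P.integrable_const_bound[of _ "exp B"]) (use eB m in \<open>auto\<close>)
    show "exp (-B) \<le> (\<integral>y. exp (g (u(i := w i + y))) \<partial>P)" "(\<integral>y. exp (g (u(i := w i + y))) \<partial>P) \<le> exp B"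
      using P.integral_ge_const[OF *] P.integral_le_const[OF *] eB by auto
  qed
  have Gexp: "exp (G u) = (\<integral>y. exp (g (u(i := w i + y))) \<partial>P)"
    if u: "u \<in> space (\<Pi>\<^sub>M i\<in>I. borel)" for u
    using int_bd[OF u] by (simp add: G_def) (smt (verit) exp_gt_zero exp_ln)
  have Gm[measurable]: "G \<in> borel_measurable (\<Pi>\<^sub>M i\<in>I. borel)"
  proof -
    have "(\<lambda>(u, y). u(i := w i + y)) \<in> (\<Pi>\<^sub>M i\<in>I. borel) \<Otimes>\<^sub>M P \<rightarrow>\<^sub>M (\<Pi>\<^sub>M i\<in>insert i I. borel)"
      unfolding split_beta' by (rule measurable_fun_upd[where J=I]) measurable
    from measurable_compose[OF this g]
    have [measurable]: "(\<lambda>(u, y). g (u(i := w i + y))) \<in> borel_measurable ((\<Pi>\<^sub>M i\<in>I. borel) \<Otimes>\<^sub>M P)"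
      by (simp add: split_beta')
    show ?thesis unfolding G_def by measurable
  qed
  have sp: "(\<lambda>k\<in>I. u k + e k) \<in> space (\<Pi>\<^sub>M i\<in>I. borel)" for u e :: "'i \<Rightarrow> 'a"
    by (simp add: space_PiM)
  have shift[measurable]: "(\<lambda>e. \<lambda>k\<in>J. u k + e k) \<in> (\<Pi>\<^sub>M i\<in>J. P) \<rightarrow>\<^sub>M (\<Pi>\<^sub>M i\<in>J. borel)"
    for u :: "'i \<Rightarrow> 'a" and J by measurable
  have GB: "\<bar>G u\<bar> \<le> B" if u: "u \<in> space (\<Pi>\<^sub>M i\<in>I. borel)" for u
    using int_bd[OF u] Gexp[OF u] by (metis abs_le_iff exp_le_cancel_iff minus_le_iff)
  \<comment> \<open>The induction hypothesis wants a bound at every function, but \<open>GB\<close>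
    holds only on the extensional ones; clipping at \<open>B\<close> leaves \<open>G\<close>
    unchanged on the space.\<close>
  define G' where "G' u = max (-B) (min B (G u))" for u
  have G': "G' u = G u" if u: "u \<in> space (\<Pi>\<^sub>M i\<in>I. borel)" for u
    using GB[OF u] by (auto simp: G'_def)
  have B0: "B \<ge> 0" using B[of undefined] by linarith
  have fub: "(\<integral>e. h (\<lambda>k\<in>insert i I. u k + e k) \<partial>(\<Pi>\<^sub>M i\<in>insert i I. P))
      = (\<integral>e. (\<integral>y. h ((\<lambda>k\<in>I. u k + e k)(i := u i + y)) \<partial>P) \<partial>(\<Pi>\<^sub>M i\<in>I. P))"
    if [measurable]: "h \<in> borel_measurable (\<Pi>\<^sub>M i\<in>insert i I. borel)" and hB: "\<And>x. \<bar>h x\<bar> \<le> B'"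
    for h :: "_ \<Rightarrow> real" and u B'
    by (subst pp.product_integral_insert)
       (use insert.hyps hB in \<open>auto simp: upd[simplified] intro!: PI'.integrable_const_bound[of _ B']\<close>)
  have fub_int: "integrable (\<Pi>\<^sub>M i\<in>I. P) (\<lambda>e. \<integral>y. g ((\<lambda>k\<in>I. u k + e k)(i := u i + y)) \<partial>P)" for u
  proof -
    have "(\<lambda>(e, y). (\<lambda>k\<in>I. u k + e k)(i := u i + y)) \<in> (\<Pi>\<^sub>M i\<in>I. P) \<Otimes>\<^sub>M P \<rightarrow>\<^sub>M (\<Pi>\<^sub>M i\<in>insert i I. borel)"
      unfolding split_beta' by (rule measurable_fun_upd[where J=I]) measurable
    from measurable_compose[OF this g]
    have [measurable]: "(\<lambda>(e, y). g ((\<lambda>k\<in>I. u k + e k)(i := u i + y))) \<in> borel_measurable ((\<Pi>\<^sub>M i\<in>I. P) \<Otimes>\<^sub>M P)"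
      by (simp add: split_beta')
    have "\<bar>\<integral>y. g ((\<lambda>k\<in>I. u k + e k)(i := u i + y)) \<partial>P\<bar> \<le> B" for e
    proof -
      have m: "(\<lambda>y. g ((\<lambda>k\<in>I. u k + e k)(i := u i + y))) \<in> borel_measurable borel"
        using measurable_compose[OF _ sec[OF sp[of u e]], of "\<lambda>y. u i + y" borel] by simp
      have ii: "integrable P (\<lambda>y. g ((\<lambda>k\<in>I. u k + e k)(i := u i + y)))"
        by (intro P.integrable_const_bound[of _ B]) (use B m in auto)
      show ?thesis
        using P.integral_le_const[OF ii, of B] P.integral_ge_const[OF ii, of "-B"] B
        by (auto simp: abs_le_iff minus_le_iff)
    qed
    then show ?thesis by (intro PI.integrable_const_bound[of _ B]) auto
  qed
  have "(\<integral>e. g (\<lambda>k\<in>insert i I. v k + e k) \<partial>(\<Pi>\<^sub>M i\<in>insert i I. P))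
      = (\<integral>e. (\<integral>y. g ((\<lambda>k\<in>I. v k + e k)(i := v i + y)) \<partial>P) \<partial>(\<Pi>\<^sub>M i\<in>I. P))"
    by (rule fub[OF g B])
  also have "\<dots> \<le> (\<integral>e. c * (norm (v i - w i))\<^sup>2 + G' (\<lambda>k\<in>I. v k + e k) \<partial>(\<Pi>\<^sub>M i\<in>I. P))"
  proof (intro integral_mono fub_int)
    show "integrable (\<Pi>\<^sub>M i\<in>I. P) (\<lambda>e. c * (norm (v i - w i))\<^sup>2 + G' (\<lambda>k\<in>I. v k + e k))"
      by (intro Bochner_Integration.integrable_add PI.integrable_const_bound[of "\<lambda>e. G' (\<lambda>k\<in>I. v k + e k)" B])
        (use B0 in \<open>auto simp: G'_def abs_le_iff\<close>)
    fix e :: "'i \<Rightarrow> 'a"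
    show "(\<integral>y. g ((\<lambda>k\<in>I. v k + e k)(i := v i + y)) \<partial>P)
        \<le> c * (norm (v i - w i))\<^sup>2 + G' (\<lambda>k\<in>I. v k + e k)"
      unfolding G'[OF sp] G_def
      by (rule noise_shift_variational[OF P S nc sec[OF sp] B])
  qed
  also have "\<dots> = c * (norm (v i - w i))\<^sup>2 + (\<integral>e. G' (\<lambda>k\<in>I. v k + e k) \<partial>(\<Pi>\<^sub>M i\<in>I. P))"
    by (subst Bochner_Integration.integral_add)
       (use B0 in \<open>auto simp: G'_def abs_le_iff PI.prob_space intro!: PI.integrable_const_bound[of _ B]\<close>)
  also have "(\<integral>e. G' (\<lambda>k\<in>I. v k + e k) \<partial>(\<Pi>\<^sub>M i\<in>I. P))
      \<le> (\<Sum>i\<in>I. c * (norm (v i - w i))\<^sup>2) + ln (\<integral>e. exp (G' (\<lambda>i\<in>I. w i + e i)) \<partial>(\<Pi>\<^sub>M i\<in>I. P))"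
    by (rule insert.IH[where B=B]) (use B0 in \<open>auto simp: G'_def\<close>)
  also have "(\<integral>e. exp (G' (\<lambda>i\<in>I. w i + e i)) \<partial>(\<Pi>\<^sub>M i\<in>I. P))
      = (\<integral>e. exp (g (\<lambda>k\<in>insert i I. w k + e k)) \<partial>(\<Pi>\<^sub>M i\<in>insert i I. P))"
    unfolding G'[OF sp] Gexp[OF sp]
    by (rule fub[symmetric, of "\<lambda>x. exp (g x)" "exp B"]) (use eB in auto)
  finally show ?case unfolding sum.insert[OF insert.hyps] by (simp only: add.assoc)
qed

text \<open>Testing the variational inequality against multiples of indicators gives a form of Fano's
  inequality.\<close>

lemma fano_counting:
  fixes Q :: "'b measure" and P :: "'k \<Rightarrow> 'b measure" and A :: "'k \<Rightarrow> 'b set"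
    and \<kappa> b :: real
  assumes Q: "prob_space Q" and P: "\<And>k. k \<in> K \<Longrightarrow> prob_space (P k)"
    and S: "\<And>k. k \<in> K \<Longrightarrow> sets (P k) = sets Q"
    and var: "\<And>k g B. k \<in> K \<Longrightarrow> g \<in> borel_measurable Q \<Longrightarrow> (\<And>y. \<bar>g y\<bar> \<le> B) \<Longrightarrow>
        (\<integral>y. g y \<partial>P k) \<le> \<kappa> + ln (\<integral>y. exp (g y) \<partial>Q)"
    and K: "finite K" "K \<noteq> {}" and A: "\<And>k. k \<in> K \<Longrightarrow> A k \<in> sets Q"
    and count: "\<And>y. y \<in> space Q \<Longrightarrow> real (card {k\<in>K. y \<in> A k}) \<le> b" and b: "b > 0"
  shows "(\<Sum>k\<in>K. measure (P k) (A k)) * ln (card K / b) \<le> card K * (\<kappa> + 1)"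
proof -
  interpret Q: prob_space Q by fact
  \<comment> \<open>The multiplier is chosen so that \<open>exp l * b = card K\<close>: the bound
    \<open>b\<close> on the total \<open>Q\<close>-mass then contributes one unit per
    hypothesis.\<close>
  define l where "l = ln (card K / b)"
  have el: "exp l = card K / b" using K b by (auto simp: l_def card_gt_0_iff)
  have one: "measure (P k) (A k) * l \<le> \<kappa> + exp l * measure Q (A k)" if k: "k \<in> K" for k
  proof -
    interpret P: prob_space "P k" by (rule P) fact
    have [measurable_cong]: "sets (P k) = sets Q" by (rule S) fact
    have [measurable]: "A k \<in> sets Q" by (rule A) fact
    have "measure (P k) (A k) * l = (\<integral>y. l * indicator (A k) y \<partial>P k)"
      using A[OF k] S[OF k] sets.sets_into_space[of "A k" "P k"]
      by (simp add: Int_absorb2 mult.commute)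
    also have "\<dots> \<le> \<kappa> + ln (\<integral>y. exp (l * indicator (A k) y) \<partial>Q)"
      by (rule var[OF k, of _ "\<bar>l\<bar>"]) (auto simp: indicator_def)
    also have "(\<integral>y. exp (l * indicator (A k) y) \<partial>Q) = (\<integral>y. 1 + (exp l - 1) * indicator (A k) y \<partial>Q)"
      by (intro Bochner_Integration.integral_cong) (auto simp: indicator_def)
    also have "\<dots> = 1 + (exp l - 1) * measure Q (A k)"
      using A[OF k] sets.sets_into_space[of "A k" "Q"]
      by (subst Bochner_Integration.integral_add) (auto simp: Int_absorb2 Q.prob_space less_top[symmetric] intro!: integrable_real_indicator)
    also have "ln \<dots> \<le> exp l * measure Q (A k)"
    proof -
      \<comment> \<open>\<open>l\<close> is negative when \<open>b\<close> exceeds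
        \<open>card K\<close>, so the argument of \<open>ln\<close> is not positive for trivial
        reasons.\<close>
      have "1 + (exp l - 1) * measure Q (A k) > 0"
      proof (cases "measure Q (A k) = 1")
        case False
        then have "measure Q (A k) < 1" using Q.prob_le_1[of "A k"] by linarith
        then show ?thesis
            using mult_nonneg_nonneg[of "exp l" "measure Q (A k)"]
            by (simp add: algebra_simps del: mult_nonneg_nonneg zero_le_mult_iff)
      qed auto
      from ln_le_minus_one[OF this] show ?thesis
        by (simp add: algebra_simps) (smt (verit) measure_nonneg)
    qed
    finally show ?thesis by simp
  qed
  \<comment> \<open>The \<open>Q\<close>-masses add up to the expected number of sets
    \<open>A k\<close> containing a point, which turns the pointwise count into a bound on
    masses.\<close>
  have "(\<Sum>k\<in>K. measure Q (A k)) = (\<integral>y. (\<Sum>k\<in>K. indicator (A k) y) \<partial>Q)"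
    using A sets.sets_into_space[of _ Q]
    by (subst Bochner_Integration.integral_sum) (auto simp: Int_absorb2 less_top[symmetric] intro!: sum.cong)
  also have "\<dots> \<le> (\<integral>y. b \<partial>Q)"
  proof (intro integral_mono Bochner_Integration.integrable_sum)
    fix y assume "y \<in> space Q"
    from count[OF this] show "(\<Sum>k\<in>K. indicator (A k) y) \<le> b"
      using K by (simp add: indicator_def sum.If_cases Int_def)
  qed (use A in \<open>auto simp: less_top[symmetric] intro!: integrable_real_indicator\<close>)
  finally have sQ: "(\<Sum>k\<in>K. measure Q (A k)) \<le> b" by (simp add: Q.prob_space)
  have "(\<Sum>k\<in>K. measure (P k) (A k)) * l \<le> (\<Sum>k\<in>K. \<kappa> + exp l * measure Q (A k))"
    unfolding sum_distrib_right by (intro sum_mono one)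
  also have "\<dots> = card K * \<kappa> + exp l * (\<Sum>k\<in>K. measure Q (A k))"
    by (simp add: sum.distrib sum_distrib_left)
  also have "\<dots> \<le> card K * \<kappa> + exp l * b" using sQ by simp
  also have "\<dots> = card K * (\<kappa> + 1)" using b by (simp add: el algebra_simps)
  finally show ?thesis by (simp add: l_def)
qed

section \<open>Laws of the observations and reduction of the minimax probability to counting\<close>

lemma sets_obs_law [simp]: "sets (obs_law m n t x P f) = sets (obs_space m n)"
  by (simp add: obs_law_def)

lemma obs_shift_measurable:
  fixes P :: "'a::euclidean_space measure"
  assumes [measurable_cong]: "sets P = sets borel"
  shows "(\<lambda>e. \<lambda>i\<in>I. v i + e i) \<in> (\<Pi>\<^sub>M i\<in>I. P) \<rightarrow>\<^sub>M (\<Pi>\<^sub>M i\<in>I. borel)"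
  by measurable

text \<open>Brings the law into the shape of \<open>product_shift_variational\<close>: the noise is
  shifted coordinate by coordinate, by the values of the trajectories.\<close>

lemma obs_law_altdef:
  "obs_law m n t x P f = distr (\<Pi>\<^sub>M i\<in>obs_index m n. P) (\<Pi>\<^sub>M i\<in>obs_index m n. borel)
     (\<lambda>e. \<lambda>i\<in>obs_index m n. flow f (x (fst i)) (t (fst i) (snd i)) + e i)"
  unfolding obs_law_def obs_space_def by (simp add: split_beta')

text \<open>The loss of an estimator need not be measurable in the data, so the events entering Fano's
  inequality are complements of measurable covers of the error events.\<close>

lemma minimax_prob_ge_quarter:
  fixes P :: "'a::euclidean_space measure" and f :: "'k \<Rightarrow> 'a \<Rightarrow> 'a" and \<kappa> b :: real
  assumes P: "prob_space P" and S: "sets P = sets borel" and nc: "noise_condition c P"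
    and K: "finite K" "K \<noteq> {}" and F: "\<And>k. k \<in> K \<Longrightarrow> f k \<in> F"
    and kl: "\<And>k. k \<in> K \<Longrightarrow>
       (\<Sum>(j, i)\<in>obs_index m n. c * (norm (flow (f k) (x j) (t j i) - flow ref (x j) (t j i)))\<^sup>2) \<le> \<kappa>"
    and count: "\<And>g. g \<in> borel_measurable borel \<Longrightarrow> real (card {k\<in>K. \<not> E g (f k)}) \<le> b"
    and b: "b > 0" and \<kappa>: "\<kappa> \<ge> 0" "\<kappa> + 1 \<le> 3 / 4 * ln (card K / b)"
  shows "minimax_prob m n t x P F E \<ge> 1 / 4"
  unfolding minimax_prob_def
proof (rule INF_greatest)
  fix fh :: "(nat \<times> nat \<Rightarrow> 'a) \<Rightarrow> 'a \<Rightarrow> 'a"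
  assume fh: "fh \<in> estimators m n"
  let ?Y = "obs_space m n :: (nat \<times> nat \<Rightarrow> 'a) measure" and ?L = "obs_law m n t x P"
  define Err where "Err k = {y\<in>space ?Y. E (fh y) (f k)}" for k
  have fin: "finite (obs_index m n)" by (simp add: obs_index_def)
  have pI: "prob_space (\<Pi>\<^sub>M i\<in>obs_index m n. P)" by (rule prob_space_PiM) (rule P)
  have pL: "prob_space (?L g)" for g
    unfolding obs_law_altdef using obs_shift_measurable[OF S]
    by (rule prob_space.prob_space_distr[OF pI])
  have var: "(\<integral>y. g y \<partial>?L (f k)) \<le> \<kappa> + ln (\<integral>y. exp (g y) \<partial>?L ref)"
    if k: "k \<in> K" and g: "g \<in> borel_measurable (?L ref)" and B: "\<And>y. \<bar>g y\<bar> \<le> B" for k g B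
  proof -
    have g': "g \<in> borel_measurable (\<Pi>\<^sub>M i\<in>obs_index m n. borel)"
      using g by (simp add: obs_law_def obs_space_def)
    have "(\<integral>y. g y \<partial>?L h) =
        (\<integral>e. g (\<lambda>i\<in>obs_index m n. flow h (x (fst i)) (t (fst i) (snd i)) + e i)
           \<partial>(\<Pi>\<^sub>M i\<in>obs_index m n. P))"
        "(\<integral>y. exp (g y) \<partial>?L h) =
        (\<integral>e. exp (g (\<lambda>i\<in>obs_index m n. flow h (x (fst i)) (t (fst i) (snd i)) + e i))
           \<partial>(\<Pi>\<^sub>M i\<in>obs_index m n. P))" for h
      unfolding obs_law_altdef using g'
      by (intro integral_distr obs_shift_measurable[OF S]; measurable)+
    with product_shift_variational[OF P S nc fin g' B,
       of "\<lambda>i. flow (f k) (x (fst i)) (t (fst i) (snd i))" "\<lambda>i. flow ref (x (fst i)) (t (fst i) (snd i))"]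
      kl[OF k]
    show ?thesis by (simp add: split_beta')
  qed
  show "1 / 4 \<le> (SUP g\<in>F. outer_measure_of (?L g) {y \<in> space ?Y. E (fh y) g})"
  proof (rule ccontr)
    assume "\<not> ?thesis"
    then have less: "outer_measure_of (?L (f k)) (Err k) < 1 / 4" if "k \<in> K" for k
      using F[OF that] unfolding Err_def by (meson SUP_upper le_less_trans not_le)
    \<comment> \<open>The outer measure is an infimum over measurable supersets, so one of them
      already has measure below 1/4.\<close>
    have "\<exists>S. S \<in> sets ?Y \<and> Err k \<subseteq> S \<and> emeasure (?L (f k)) S < 1 / 4" if k: "k \<in> K" for k
      using less[OF k] unfolding outer_measure_of_def INF_less_iff by auto
    then obtain S where S: "\<And>k. k \<in> K \<Longrightarrow> S k \<in> sets ?Y \<and> Err k \<subseteq> S k \<and> emeasure (?L (f k)) (S k) < 1 / 4"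
      by metis
    define A where "A k = space ?Y - S k" for k
    have big: "measure (?L (f k)) (A k) > 3 / 4" if k: "k \<in> K" for k
    proof -
      interpret L: prob_space "?L (f k)" by (rule pL)
      have sp: "space (?L (f k)) = space ?Y" by (rule sets_eq_imp_space_eq) simp
      have "ennreal (measure (?L (f k)) (S k)) < ennreal (1 / 4)"
        using S[OF k] by (simp add: L.emeasure_eq_measure[symmetric] divide_ennreal[symmetric])
      then have "measure (?L (f k)) (S k) < 1 / 4" by (simp add: ennreal_less_iff)
      moreover have "measure (?L (f k)) (A k) = 1 - measure (?L (f k)) (S k)"
        using L.prob_compl[of "S k"] S[OF k] by (simp add: A_def sp)
      ultimately show ?thesis by simp
    qed
    have "(\<Sum>k\<in>K. measure (?L (f k)) (A k)) * ln (card K / b) \<le> card K * (\<kappa> + 1)"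
    proof (rule fano_counting[OF pL[of ref] pL _ var K _ _ b])
      fix y assume y: "y \<in> space (?L ref)"
      then have y': "y \<in> space ?Y" by (simp add: obs_law_def)
      have "card {k\<in>K. y \<in> A k} \<le> card {k\<in>K. \<not> E (fh y) (f k)}"
        using K S y' by (intro card_mono) (auto simp: A_def Err_def)
      also have "real \<dots> \<le> b"
        using fh y' by (intro count) (auto simp: estimators_def)
      finally show "real (card {k\<in>K. y \<in> A k}) \<le> b" by simp
    qed (use S in \<open>auto simp: A_def\<close>)
    moreover have "card K * (3 / 4) * ln (card K / b) < (\<Sum>k\<in>K. measure (?L (f k)) (A k)) * ln (card K / b)"
    proof (rule mult_strict_right_mono)
      have "(\<Sum>k\<in>K. 3 / 4) < (\<Sum>k\<in>K. measure (?L (f k)) (A k))"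
        by (rule sum_strict_mono) (use K big in auto)
      then show "card K * (3 / 4) < (\<Sum>k\<in>K. measure (?L (f k)) (A k))" by simp
      show "0 < ln (card K / b)" using \<kappa> by linarith
    qed
    moreover have "card K * (\<kappa> + 1) \<le> card K * (3 / 4 * ln (card K / b))"
      using \<kappa> by (intro mult_left_mono) auto
    ultimately show False by simp
  qed
qed

section \<open>Flows of bounded Lipschitz fields\<close>

context
  fixes f :: "'a::euclidean_space \<Rightarrow> 'a" and L :: real
  assumes lip: "\<And>x y. norm (f x - f y) \<le> L * norm (x - y)" and L: "L > 0"
begin

text \<open>The energy |u - v|^2 changes at relative rate at most 2 L. Hence exp (-2 L t) times the
  energy is nonincreasing and exp (2 L t) times it is nondecreasing, which forces it to vanish after
  and before time 0. Both directions matter because \<open>flow\<close> selects a solution on the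
  whole line.\<close>

lemma ode_solution_unique:
  assumes u: "\<And>t. (u has_vector_derivative f (u t)) (at t)"
    and v: "\<And>t. (v has_vector_derivative f (v t)) (at t)" and uv: "u 0 = v 0"
  shows "u = v"
proof
  fix t :: real
  define w where "w s = u s - v s" for s
  have ip: "\<bar>w s \<bullet> (f (u s) - f (v s))\<bar> \<le> L * (w s \<bullet> w s)" for s
  proof -
    have "\<bar>w s \<bullet> (f (u s) - f (v s))\<bar> \<le> norm (w s) * norm (f (u s) - f (v s))"
      by (rule Cauchy_Schwarz_ineq2)
    also have "\<dots> \<le> norm (w s) * (L * norm (w s))"
      unfolding w_def by (intro mult_left_mono lip) auto
    finally show ?thesis by (simp add: dot_square_norm power2_eq_square mult_ac)
  qed
  have w': "(w has_vector_derivative f (u s) - f (v s)) (at s)" for s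
    unfolding w_def by (intro has_vector_derivative_diff u v)
  have der: "((\<lambda>s. exp (c * s) * (w s \<bullet> w s)) has_real_derivative
      exp (c * s) * (c * (w s \<bullet> w s) + 2 * (w s \<bullet> (f (u s) - f (v s))))) (at s)" for c s
  proof -
    have "((\<lambda>s. w s \<bullet> w s) has_real_derivative 2 * (w s \<bullet> (f (u s) - f (v s)))) (at s)"
      using has_derivative_inner[OF w'[of s, unfolded has_vector_derivative_def] w'[of s, unfolded has_vector_derivative_def]]
      by (simp add: has_field_derivative_def inner_commute mult_ac)
        (rule has_derivative_eq_rhs, assumption, auto simp: fun_eq_iff inner_commute)
    then show ?thesis
      by (auto intro!: derivative_eq_intros simp: algebra_simps)
  qed
  have "w t \<bullet> w t \<le> 0"
  proof (cases "t \<ge> 0")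
    case True
    have "exp ((- 2 * L) * t) * (w t \<bullet> w t) \<le> exp ((- 2 * L) * 0) * (w 0 \<bullet> w 0)"
    proof (rule DERIV_nonpos_imp_nonincreasing[OF True], intro exI conjI)
      fix s show "((\<lambda>s. exp ((- 2 * L) * s) * (w s \<bullet> w s)) has_real_derivative
        exp ((-2 * L) * s) * ((-2 * L) * (w s \<bullet> w s) + 2 * (w s \<bullet> (f (u s) - f (v s))))) (at s)"
        by (rule der)
      show "exp ((-2 * L) * s) * ((-2 * L) * (w s \<bullet> w s) + 2 * (w s \<bullet> (f (u s) - f (v s)))) \<le> 0"
        using ip[of s] by (intro mult_nonneg_nonpos) auto
    qed
    then show ?thesis using uv by (simp add: w_def mult_le_0_iff)
  next
    case False
    then have t: "t \<le> 0" by simp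
    have "exp ((2 * L) * t) * (w t \<bullet> w t) \<le> exp ((2 * L) * 0) * (w 0 \<bullet> w 0)"
    proof (rule DERIV_nonneg_imp_nondecreasing[OF t], intro exI conjI)
      fix s show "((\<lambda>s. exp ((2 * L) * s) * (w s \<bullet> w s)) has_real_derivative
        exp ((2 * L) * s) * ((2 * L) * (w s \<bullet> w s) + 2 * (w s \<bullet> (f (u s) - f (v s))))) (at s)"
        by (rule der)
      show "0 \<le> exp ((2 * L) * s) * ((2 * L) * (w s \<bullet> w s) + 2 * (w s \<bullet> (f (u s) - f (v s))))"
        using ip[of s] by (intro mult_nonneg_nonneg) auto
    qed
    then show ?thesis using uv by (simp add: w_def mult_le_0_iff)
  qed
  then show "u t = v t" by (simp add: w_def) (metis eq_iff_diff_eq_0 inner_gt_zero_iff not_le)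
qed

text \<open>Integrating \<open>L * D * exp (2 * L * s)\<close> returns half of
  \<open>D * exp (2 * L * s)\<close>, up to a constant: the exponent 2 L produces the 1/2 that
  becomes the contraction factor. The lemma serves with \<open>D = B / L\<close> for the boundedness
  of Picard's operator and with \<open>D = dist g g'\<close> for the contraction. Negative times
  follow by reflection.\<close>

lemma weighted_growth_bound:
  fixes G :: "real \<Rightarrow> 'a"
  assumes G: "\<And>t. (G has_vector_derivative k t) (at t)" "G 0 = 0"
    and k: "\<And>s. norm (k s) \<le> L * D * exp (2 * L * \<bar>s\<bar>)" and D: "D \<ge> 0"
  shows "norm (G t) \<le> D / 2 * exp (2 * L * \<bar>t\<bar>)"
proof -
  have pos: "norm (H t) \<le> D / 2 * exp (2 * L * t)"
    if H: "\<And>t. (H has_vector_derivative k t) (at t)" "H 0 = 0"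
      and k: "\<And>s. norm (k s) \<le> L * D * exp (2 * L * \<bar>s\<bar>)" and t: "t > 0" for H :: "real \<Rightarrow> 'a" and k t
  proof -
    have "norm (H t - H 0) \<le> D / 2 * exp (2 * L * t) - D / 2 * exp (2 * L * 0)"
    proof (rule differentiable_bound_general[OF t, where f' = k and \<phi>' = "\<lambda>s. L * D * exp (2 * L * s)"])
      show "continuous_on {0..t} H"
        by (meson H continuous_at_imp_continuous_on has_vector_derivative_continuous)
      show "continuous_on {0..t} (\<lambda>t. D / 2 * exp (2 * L * t))" by (intro continuous_intros)
      show "((\<lambda>t. D / 2 * exp (2 * L * t)) has_vector_derivative L * D * exp (2 * L * s)) (at s)" for s
        unfolding has_real_derivative_iff_has_vector_derivative[symmetric]
        by (auto intro!: derivative_eq_intros)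
      show "norm (k s) \<le> L * D * exp (2 * L * s)" if "0 < s" for s using k[of s] that by simp
    qed (rule H)
    with H D show ?thesis by simp
  qed
  consider "t > 0" | "t = 0" | "t < 0" by linarith
  then show ?thesis
  proof cases
    case 1 then show ?thesis using pos[OF G k 1] by simp
  next
    case 2 then show ?thesis using G D by simp
  next
    case 3
    have "((\<lambda>s. G (- s)) has_vector_derivative - k (- s)) (at s)" for s
    proof -
      have "((\<lambda>s::real. - s) has_vector_derivative - 1) (at s)"
        by (auto intro!: derivative_eq_intros)
      from vector_diff_chain_at[OF this G(1)[of "- s"]]
      show ?thesis by (simp add: o_def)
    qed
    moreover have "norm (- k (- s)) \<le> L * D * exp (2 * L * \<bar>s\<bar>)" for s using k[of "- s"] by simp
    ultimately show ?thesis using pos[of "\<lambda>s. G (- s)" "\<lambda>s. - k (- s)" "- t"] 3 G(2) by simp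
  qed
qed

text \<open>Picard's operator, conjugated with the weight \<open>exp (2 * L * \<bar>t\<bar>)\<close>, is a contraction of the
  space of bounded continuous functions on the whole line.\<close>

lemma ode_solution_exists:
  assumes B: "\<And>x. norm (f x) \<le> B"
  shows "\<exists>u. u 0 = x \<and> (\<forall>t. (u has_vector_derivative f (u t)) (at t))"
proof -
  define W where "W t = exp (2 * L * \<bar>t\<bar>)" for t
  \<comment> \<open>The unknown \<open>g\<close> is the weighted displacement: the curve is
    \<open>x + W s *\<^sub>R g s\<close>, and \<open>h g\<close> is the velocity prescribed along
    it.\<close>
  define h where "h g s = f (x + W s *\<^sub>R apply_bcontfun g s)" for g s
  define I where "I k t = (LBINT s=0..t. k s)" for k :: "real \<Rightarrow> 'a" and t :: real
  have W: "W t > 0" "continuous_on S W" for t S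
    by (auto simp: W_def intro!: continuous_intros)
  have I0: "I k 0 = 0" for k by (simp add: I_def zero_ereal_def[symmetric])
  have I': "(I k has_vector_derivative k t) (at t)" if k: "continuous_on UNIV k" for k t
  proof -
    \<comment> \<open>The interval contains 0 and has \<open>t\<close> in its interior, so the
      derivative within it is a full derivative.\<close>
    have "((\<lambda>u. LBINT y=(0::real)..u. k y) has_vector_derivative k t) (at t within {-\<bar>t\<bar> - 1..\<bar>t\<bar> + 1})"
      by (rule interval_integral_FTC2) (auto intro: continuous_on_subset[OF k])
    then show ?thesis unfolding I_def
      by (subst (asm) at_within_interior) (auto simp: zero_ereal_def)
  qed
  have Icont: "continuous_on UNIV (I k)" if "continuous_on UNIV k" for k
    using I'[OF that] by (meson continuous_at_imp_continuous_on has_vector_derivative_continuous)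
  have fcont: "continuous_on UNIV f"
  proof (rule continuous_onI)
    fix x e :: real and y :: 'a assume "e > 0"
    then show "\<exists>d>0. \<forall>x'\<in>UNIV. dist x' y < d \<longrightarrow> dist (f x') (f y) \<le> e"
      using L lip by (intro exI[of _ "e / L"]) (auto simp: dist_norm field_simps intro: order.trans[OF lip] less_imp_le)
  qed
  have hcont: "continuous_on UNIV (h g)" for g
    unfolding h_def by (rule continuous_on_compose2[OF fcont]) (auto intro!: continuous_intros W)
  define \<Phi> where "\<Phi> g = Bcontfun (\<lambda>t. I (h g) t /\<^sub>R W t)" for g
  have bnd: "norm (I (h g) t) \<le> B / (2 * L) * W t" for g t
  proof -
    have "norm (I (h g) t) \<le> (B / L) / 2 * exp (2 * L * \<bar>t\<bar>)"
    proof (rule weighted_growth_bound[OF I'[OF hcont] I0])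
      have "B \<ge> 0" using B[of x] norm_ge_zero order.trans by blast
      then show "B / L \<ge> 0" using L by simp
      have "B * 1 \<le> B * exp (2 * L * \<bar>s\<bar>)" for s
        using \<open>B \<ge> 0\<close> L by (intro mult_left_mono) auto
      then show "norm (h g s) \<le> L * (B / L) * exp (2 * L * \<bar>s\<bar>)" for s
        using B[of "x + W s *\<^sub>R apply_bcontfun g s"] L unfolding h_def
        by simp (meson order.trans)
    qed
    then show ?thesis by (simp add: W_def mult.commute)
  qed
  have \<Phi>: "apply_bcontfun (\<Phi> g) t = I (h g) t /\<^sub>R W t" for g t
  proof -
    have "(\<lambda>t. I (h g) t /\<^sub>R W t) \<in> bcontfun"
      unfolding bcontfun_def bounded_iff
      using bnd[of g] W Icont[OF hcont[of g]]
      by (auto intro!: continuous_intros exI[of _ "B / (2 * L)"] simp: less_imp_neq[OF W(1), symmetric] abs_of_pos[OF W(1)] field_simps)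
    then show ?thesis by (simp add: \<Phi>_def Bcontfun_inverse)
  qed
  have "dist (\<Phi> g) (\<Phi> g') \<le> 1 / 2 * dist g g'" for g g'
  proof (rule dist_bound)
    fix t
    have "norm (I (h g) t - I (h g') t) \<le> dist g g' / 2 * exp (2 * L * \<bar>t\<bar>)"
    proof (rule weighted_growth_bound[OF has_vector_derivative_diff[OF I'[OF hcont] I'[OF hcont]]])
      fix s
      have "norm (h g s - h g' s) \<le> L * norm (W s *\<^sub>R (apply_bcontfun g s - apply_bcontfun g' s))"
        unfolding h_def by (rule order.trans[OF lip]) (simp add: algebra_simps)
      also have "\<dots> = L * (W s * dist (apply_bcontfun g s) (apply_bcontfun g' s))"
        using W(1)[of s] by (simp add: dist_norm)
      also have "\<dots> \<le> L * (W s * dist g g')"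
        using L W(1)[of s] by (intro mult_left_mono dist_bounded) auto
      finally show "norm (h g s - h g' s) \<le> L * dist g g' * exp (2 * L * \<bar>s\<bar>)"
        by (simp add: W_def mult_ac)
    qed (auto simp: I0)
    then have "norm (I (h g) t - I (h g') t) \<le> (dist g g' / 2) * W t" by (simp add: W_def)
    then have "norm (I (h g) t - I (h g') t) / W t \<le> dist g g' / 2" using W(1)[of t] by (simp add: field_simps)
    moreover have "dist (I (h g) t /\<^sub>R W t) (I (h g') t /\<^sub>R W t) = norm (I (h g) t - I (h g') t) / W t"
      using W(1)[of t] by (simp add: dist_norm scaleR_diff_right[symmetric] divide_inverse_commute)
    ultimately show "dist (apply_bcontfun (\<Phi> g) t) (apply_bcontfun (\<Phi> g') t) \<le> 1 / 2 * dist g g'"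
      by (simp add: \<Phi>)
  qed
  then have "\<exists>!g. \<Phi> g = g" by (intro banach_fix_type[of "1/2"]) auto
  then obtain g where g: "\<Phi> g = g" by blast
  define u where "u t = x + W t *\<^sub>R apply_bcontfun g t" for t
  have u: "u t = x + I (h g) t" for t
    using \<Phi>[of g t] W(1)[of t] by (simp add: u_def g)
  have "(u has_vector_derivative f (u t)) (at t)" for t
  proof -
    have "((\<lambda>t. x + I (h g) t) has_vector_derivative h g t) (at t)"
      by (auto intro!: derivative_eq_intros I' hcont)
    moreover have "h g t = f (u t)" by (simp add: h_def u_def)
    moreover have "u = (\<lambda>t. x + I (h g) t)" using u by auto
    ultimately show ?thesis by metis
  qed
  moreover have "u 0 = x" by (simp add: u I0)
  ultimately show ?thesis by blast
qed

lemma flow_solves: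
  assumes B: "\<And>x. norm (f x) \<le> B"
  shows "flow f x 0 = x" "(flow f x has_vector_derivative f (flow f x t)) (at t)"
proof -
  have "\<exists>!u. u 0 = x \<and> (\<forall>t. (u has_vector_derivative f (u t)) (at t))"
    using ode_solution_exists[OF B, of x] ode_solution_unique by (metis (no_types, lifting))
  from theI'[OF this] show "flow f x 0 = x" "(flow f x has_vector_derivative f (flow f x t)) (at t)"
    unfolding flow_def by auto
qed

lemma flow_stationary:
  assumes "f x = 0" shows "flow f x t = x"
proof -
  have "flow f x = (\<lambda>_. x)"
    unfolding flow_def
  proof (rule the_equality)
    fix u assume u: "u 0 = x \<and> (\<forall>t. (u has_vector_derivative f (u t)) (at t))"
    show "u = (\<lambda>_. x)" by (rule ode_solution_unique) (use u assms in auto)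
  qed (use assms in auto)
  then show ?thesis by simp
qed

lemma flow_displacement:
  assumes B: "\<And>x. norm (f x) \<le> B" and t: "t \<ge> 0"
  shows "norm (flow f x t - x) \<le> B * t"
proof (cases "t = 0")
  case False
  then have t: "0 < t" using t by simp
  have "norm (flow f x t - flow f x 0) \<le> B * t - B * 0"
  proof (rule differentiable_bound_general[OF t, where f' = "\<lambda>s. f (flow f x s)" and \<phi>' = "\<lambda>s. B"])
    show "continuous_on {0..t} (flow f x)"
      by (meson flow_solves[OF B] continuous_at_imp_continuous_on has_vector_derivative_continuous)
    show "((\<lambda>t. B * t) has_vector_derivative B) (at s)" for s
      unfolding has_real_derivative_iff_has_vector_derivative[symmetric]
      by (auto intro!: derivative_eq_intros)
  qed (auto intro!: continuous_intros flow_solves[OF B] B)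
  then show ?thesis by (simp add: flow_solves[OF B])
qed (simp add: flow_solves[OF B])

end

section \<open>Smooth bump fields\<close>

lemma power_dvd_pderiv:
  fixes q r :: "real poly"
  assumes "q ^ Suc m dvd r" shows "q ^ m dvd pderiv r"
proof -
  from assms obtain u where "r = q ^ Suc m * u" by (auto simp: dvd_def)
  then have "pderiv r = q ^ m * (q * pderiv u + u * smult (of_nat (Suc m)) (pderiv q))"
    by (simp only: pderiv_mult pderiv_power_Suc) (simp add: algebra_simps)
  then show ?thesis by simp
qed

lemma power_dvd_higher_pderiv:
  fixes q r :: "real poly"
  assumes "q ^ (m + j) dvd r" shows "q ^ m dvd (pderiv ^^ j) r"
  using assms
proof (induction j arbitrary: m)
  case (Suc j)
  then show ?case using power_dvd_pderiv[of q m "(pderiv ^^ j) r"] Suc.IH[of "Suc m"] by simp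
qed simp

text \<open>Instead of the usual exp (-1 / (1 - s^2)), a power of 1 - s^2 is cut off at |s| = 1.
  Finitely many derivatives are required and they remain cut-off polynomials; their vanishing at the
  ends becomes divisibility by \<open>[:1, 0, -1:]\<close>, the polynomial 1 - s^2.\<close>

definition cutoff_poly :: "real poly \<Rightarrow> real \<Rightarrow> real" where
  "cutoff_poly r s = (if \<bar>s\<bar> \<le> 1 then poly r s else 0)"

lemma cutoff_poly_eq_0:
  assumes "[:1, 0, -1:] dvd r" "\<bar>s\<bar> \<ge> 1" shows "cutoff_poly r s = 0"
proof (cases "\<bar>s\<bar> = 1")
  case True
  then have "poly [:1, 0, -1:] s = 0" by (auto simp: abs_if split: if_splits)
  with assms(1) have "poly r s = 0" by (auto simp: dvd_def)
  then show ?thesis by (simp add: cutoff_poly_def)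
qed (use assms in \<open>auto simp: cutoff_poly_def\<close>)

lemma cutoff_poly_has_derivative:
  assumes r: "[:1, 0, -1:] ^ 2 dvd r"
  shows "(cutoff_poly r has_real_derivative cutoff_poly (pderiv r) s) (at s)"
proof -
  have r1: "[:1, 0, -1:] dvd r" by (rule dvd_trans[OF dvd_power r]) simp
  have r2: "[:1, 0, -1:] dvd pderiv r"
    using power_dvd_pderiv[of "[:1, 0, -1:]" 1 r] r by (simp only: power_one_right Suc_1)
  have dp: "(poly r has_real_derivative poly (pderiv r) s) (at s)" by (rule poly_DERIV)
  consider "\<bar>s\<bar> < 1" | "\<bar>s\<bar> > 1" | "\<bar>s\<bar> = 1" by linarith
  then show ?thesis
  proof cases
    case 1
    have "(cutoff_poly r has_real_derivative poly (pderiv r) s) (at s)"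
      by (rule has_field_derivative_transform_within_open[OF dp, of "{-1<..<1}"])
        (use 1 in \<open>auto simp: cutoff_poly_def\<close>)
    then show ?thesis using 1 by (simp add: cutoff_poly_def)
  next
    case 2
    have "(cutoff_poly r has_real_derivative 0) (at s)"
      by (rule has_field_derivative_transform_within_open[of "\<lambda>_. 0" _ _ "- {-1..1}"])
        (use 2 in \<open>auto simp: cutoff_poly_def\<close>)
    then show ?thesis using 2 by (simp add: cutoff_poly_def)
  next
    case 3
    have c0: "cutoff_poly (pderiv r) s = 0" "cutoff_poly r s = 0"
      using cutoff_poly_eq_0[OF r2, of s] cutoff_poly_eq_0[OF r1, of s] 3 by auto
    then have p0: "poly (pderiv r) s = 0" "poly r s = 0" using 3 by (auto simp: cutoff_poly_def)
    have "((\<lambda>y. (poly r y - poly r s) / (y - s)) \<longlongrightarrow> 0) (at s)"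
      using dp p0 by (simp add: has_field_derivative_iff)
    \<comment> \<open>At an endpoint the difference quotient of the cutoff is either that of the
      polynomial or 0, so it is dominated by a quantity tending to 0.\<close>
    from tendsto_norm_zero[OF this]
    have "((\<lambda>y. (cutoff_poly r y - cutoff_poly r s) / (y - s)) \<longlongrightarrow> 0) (at s)"
      by (rule Lim_null_comparison[rotated]) (auto simp: cutoff_poly_def c0 p0)
    then show ?thesis by (simp add: has_field_derivative_iff c0)
  qed
qed

text \<open>\<open>\<psi> j\<close> plays the j-th derivative of \<open>\<psi> 0\<close>. Order n +
  1 is included because the Hoelder condition at order n is obtained from a Lipschitz bound. The
  constant \<open>c\<close> bounds the bump from below on the inner half of its support, for the L^1
  separation.\<close>

locale bump_profile =
  fixes \<psi> :: "nat \<Rightarrow> real \<Rightarrow> real" and n :: nat and B c :: real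
  assumes \<psi>_deriv: "j \<le> n \<Longrightarrow> (\<psi> j has_real_derivative \<psi> (Suc j) s) (at s)"
    and \<psi>_bound: "j \<le> Suc n \<Longrightarrow> \<bar>\<psi> j s\<bar> \<le> B"
    and \<psi>_outside: "j \<le> Suc n \<Longrightarrow> \<bar>s\<bar> \<ge> 1 \<Longrightarrow> \<psi> j s = 0"
    and \<psi>_0: "\<psi> 0 s \<ge> 0" "\<psi> 0 s \<le> 1" "\<psi> 0 0 = 1"
    and \<psi>_lower: "\<bar>s\<bar> \<le> 1 / 2 \<Longrightarrow> \<psi> 0 s \<ge> c"
    and c_pos: "c > 0" and B_ge_1: "B \<ge> 1"

lemma bump_profile_exists: "\<exists>\<psi> B c. bump_profile \<psi> n B c"
proof -
  define q :: "real poly" where "q = [:1, 0, -1:]"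
  \<comment> \<open>Each derivative costs one factor 1 - s^2. With exponent n + 2, derivatives up to
    order n still contain its square, as differentiating a cutoff requires, and the one of order n +
    1 contains one factor, so it vanishes at the ends.\<close>
  define p where "p = q ^ (n + 2)"
  define \<psi> where "\<psi> j = cutoff_poly ((pderiv ^^ j) p)" for j
  have dvd: "q ^ m dvd (pderiv ^^ j) p" if "m + j \<le> n + 2" for m j
    unfolding p_def by (intro power_dvd_higher_pderiv le_imp_power_dvd that)
  have "\<exists>B. \<forall>s. \<bar>\<psi> j s\<bar> \<le> B" for j
  proof -
    have "bounded (poly ((pderiv ^^ j) p) ` {-1..1})"
      by (intro compact_imp_bounded compact_continuous_image continuous_intros) auto
    then obtain B where B: "\<And>s. \<bar>s\<bar> \<le> 1 \<Longrightarrow> \<bar>poly ((pderiv ^^ j) p) s\<bar> \<le> B"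
      unfolding bounded_iff by (fastforce simp: abs_le_iff)
    have "\<bar>\<psi> j s\<bar> \<le> max 0 B" for s
      using B[of s] by (auto simp: \<psi>_def cutoff_poly_def)
    then show ?thesis by blast
  qed
  then obtain b where b: "\<And>j s. \<bar>\<psi> j s\<bar> \<le> b j" by metis
  have \<psi>0: "\<psi> 0 s = (if \<bar>s\<bar> \<le> 1 then (1 - s\<^sup>2) ^ (n + 2) else 0)" for s
    by (simp add: \<psi>_def cutoff_poly_def p_def q_def power2_eq_square algebra_simps)
  \<comment> \<open>The summand 1 secures \<open>B_ge_1\<close>; 3/4 is the least value of 1 - s^2
    for |s| <= 1/2.\<close>
  have "bump_profile \<psi> n (1 + (\<Sum>j\<le>Suc n. b j)) ((3 / 4) ^ (n + 2))"
  proof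
    have b0: "b j \<ge> 0" for j using b[of j 0] by linarith
    show "(\<psi> j has_real_derivative \<psi> (Suc j) s) (at s)" if "j \<le> n" for j s
      using cutoff_poly_has_derivative[of "(pderiv ^^ j) p" s] dvd[of 2 j] that
      by (simp add: \<psi>_def q_def)
    show "\<bar>\<psi> j s\<bar> \<le> 1 + (\<Sum>j\<le>Suc n. b j)" if "j \<le> Suc n" for j s
      using b[of j s] member_le_sum[of j "{..Suc n}" b] that b0 by (simp del: sum.atMost_Suc)
    show "\<psi> j s = 0" if "j \<le> Suc n" "\<bar>s\<bar> \<ge> 1" for j s
      unfolding \<psi>_def using dvd[of 1 j] that by (intro cutoff_poly_eq_0) (auto simp: q_def)
    show "\<psi> 0 s \<ge> 0" "\<psi> 0 s \<le> 1" for s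
      unfolding \<psi>0 using zero_le_power[of "1 - s\<^sup>2" "n + 2"] power_le_one[of "1 - s\<^sup>2" "n + 2"]
      by (auto simp only: abs_square_le_1[of s, symmetric] split: if_split) auto
    show "\<psi> 0 0 = 1" by (simp add: \<psi>0)
    show "\<psi> 0 s \<ge> (3 / 4) ^ (n + 2)" if "\<bar>s\<bar> \<le> 1 / 2" for s
    proof -
      have "s\<^sup>2 \<le> (1 / 2)\<^sup>2" using that by (metis abs_ge_zero power2_abs power_mono)
      then have "(3 / 4) ^ (n + 2) \<le> (1 - s\<^sup>2) ^ (n + 2)"
        by (intro power_mono) (auto simp: power2_eq_square)
      then show ?thesis using that unfolding \<psi>0 by simp
    qed
    show "1 \<le> 1 + (\<Sum>j\<le>Suc n. b j)" using b0 by (simp add: sum_nonneg del: sum.atMost_Suc)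
  qed simp
  then show ?thesis by blast
qed

section \<open>Jets and membership in the smoothness class\<close>

text \<open>A jet is a family indexed by multi-indices that behaves like the partial derivatives of its
  member at the zero multi-index; \<open>jet_form\<close> expands iterated directional derivatives in it.\<close>

definition raise_index :: "('d \<Rightarrow> nat) \<Rightarrow> 'd \<Rightarrow> 'd \<Rightarrow> nat" where
  "raise_index \<alpha> i = \<alpha>(i := Suc (\<alpha> i))"

definition jet :: "nat \<Rightarrow> (('d::finite \<Rightarrow> nat) \<Rightarrow> real^'d \<Rightarrow> real) \<Rightarrow> bool" where
  "jet n G \<longleftrightarrow> (\<forall>\<alpha> x. sum \<alpha> UNIV \<le> n \<longrightarrow>
     (G \<alpha> has_derivative (\<lambda>v. \<Sum>i\<in>UNIV. v $ i * G (raise_index \<alpha> i) x)) (at x))"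

primrec jet_form :: "(('d::finite \<Rightarrow> nat) \<Rightarrow> real) \<Rightarrow> (real^'d) list \<Rightarrow> ('d \<Rightarrow> nat) \<Rightarrow> real" where
  "jet_form a [] \<alpha> = a \<alpha>"
| "jet_form a (v # vs) \<alpha> = (\<Sum>i\<in>UNIV. v $ i * jet_form a vs (raise_index \<alpha> i))"

lemma sum_raise_index [simp]: "sum (raise_index \<alpha> i) (UNIV :: 'd::finite set) = Suc (sum \<alpha> UNIV)"
  unfolding raise_index_def by (subst (1 2) sum.remove[of _ i]) (auto intro!: sum.cong)

lemma raise_index_commute: "raise_index (raise_index \<alpha> i) j = raise_index (raise_index \<alpha> j) i"
  by (auto simp: raise_index_def fun_eq_iff)

lemma jet_form_diff: "jet_form (\<lambda>\<alpha>. a \<alpha> - b \<alpha>) vs \<alpha> = jet_form a vs \<alpha> - jet_form b vs \<alpha>"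
  by (induction vs arbitrary: \<alpha>) (simp_all add: sum_subtractf right_diff_distrib)

text \<open>Expanding k unit vectors in coordinates gives d^k terms, each with a coefficient of
  modulus at most 1.\<close>

lemma jet_form_bound:
  fixes vs :: "(real^'d::finite) list"
  assumes "\<And>\<gamma>. sum \<gamma> UNIV = sum \<alpha> UNIV + length vs \<Longrightarrow> \<bar>a \<gamma>\<bar> \<le> C"
    and "\<And>v. v \<in> set vs \<Longrightarrow> norm v = 1"
  shows "\<bar>jet_form a vs \<alpha>\<bar> \<le> real CARD('d) ^ length vs * C"
  using assms
proof (induction vs arbitrary: \<alpha>)
  case (Cons v vs)
  have "\<bar>jet_form a (v # vs) \<alpha>\<bar> \<le> (\<Sum>i\<in>UNIV. \<bar>v $ i\<bar> * \<bar>jet_form a vs (raise_index \<alpha> i)\<bar>)"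
    by (simp add: abs_mult[symmetric] sum_abs)
  also have "\<dots> \<le> (\<Sum>i\<in>(UNIV::'d set). 1 * (real CARD('d) ^ length vs * C))"
  proof (intro sum_mono mult_mono)
    fix i
    show "\<bar>v $ i\<bar> \<le> 1" using component_le_norm_cart[of v i] Cons.prems(2)[of v] by simp
    show "\<bar>jet_form a vs (raise_index \<alpha> i)\<bar> \<le> real CARD('d) ^ length vs * C"
      by (rule Cons.IH) (use Cons.prems in auto)
  qed auto
  finally show ?case by (simp add: mult.assoc)
qed simp

text \<open>Differentiating the expansion places the new direction \<open>v\<close> behind the older
  head \<open>w\<close>, whereas iterated derivatives keep the newest direction in front. Swapping
  two sums repairs the order; symmetry of mixed partials is built in, as a multi-index forgets the
  order of differentiation.\<close>

lemma jet_form_has_derivative: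
  assumes G: "jet n G" and "sum \<alpha> UNIV + length vs \<le> n"
  shows "((\<lambda>x. jet_form (\<lambda>\<gamma>. G \<gamma> x) vs \<alpha>) has_derivative (\<lambda>v. jet_form (\<lambda>\<gamma>. G \<gamma> x) (v # vs) \<alpha>)) (at x)"
  using assms(2)
proof (induction vs arbitrary: \<alpha>)
  case Nil
  then show ?case using G by (simp add: jet_def)
next
  case (Cons w vs)
  have "((\<lambda>x. \<Sum>i\<in>UNIV. w $ i * jet_form (\<lambda>\<gamma>. G \<gamma> x) vs (raise_index \<alpha> i)) has_derivative
     (\<lambda>v. \<Sum>i\<in>UNIV. w $ i * jet_form (\<lambda>\<gamma>. G \<gamma> x) (v # vs) (raise_index \<alpha> i))) (at x)"
    by (intro has_derivative_sum has_derivative_mult_right Cons.IH) (use Cons.prems in simp)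
  moreover have "(\<Sum>i\<in>UNIV. w $ i * jet_form (\<lambda>\<gamma>. G \<gamma> x) (v # vs) (raise_index \<alpha> i))
      = jet_form (\<lambda>\<gamma>. G \<gamma> x) (v # w # vs) \<alpha>" for v
  proof -
    have "(\<Sum>i\<in>UNIV. w $ i * jet_form (\<lambda>\<gamma>. G \<gamma> x) (v # vs) (raise_index \<alpha> i))
        = (\<Sum>i\<in>UNIV. \<Sum>j\<in>UNIV. w $ i * (v $ j * jet_form (\<lambda>\<gamma>. G \<gamma> x) vs (raise_index (raise_index \<alpha> i) j)))"
      by (simp add: sum_distrib_left)
    also have "\<dots> = (\<Sum>j\<in>UNIV. \<Sum>i\<in>UNIV. w $ i * (v $ j * jet_form (\<lambda>\<gamma>. G \<gamma> x) vs (raise_index (raise_index \<alpha> i) j)))"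
      by (rule sum.swap)
    also have "\<dots> = jet_form (\<lambda>\<gamma>. G \<gamma> x) (v # w # vs) \<alpha>"
      by (auto simp: sum_distrib_left mult.left_commute raise_index_commute[of \<alpha>] intro!: sum.cong)
    finally show ?thesis .
  qed
  ultimately show ?case by simp
qed

text \<open>Length n + 1 is reached although \<open>jet n\<close> differentiates only members of
  order at most n: the outermost direction differentiates a form of order n.\<close>

lemma deriv_form_jet:
  assumes G: "jet n G" and "length vs \<le> Suc n"
  shows "deriv_form (G (\<lambda>_. 0)) vs = (\<lambda>x. jet_form (\<lambda>\<gamma>. G \<gamma> x) vs (\<lambda>_. 0))"
  using assms(2)
proof (induction vs)
  case (Cons v vs)
  have "frechet_derivative (\<lambda>x. jet_form (\<lambda>\<gamma>. G \<gamma> x) vs (\<lambda>_. 0)) (at x)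
      = (\<lambda>v. jet_form (\<lambda>\<gamma>. G \<gamma> x) (v # vs) (\<lambda>_. 0))" for x
    by (rule frechet_derivative_at[symmetric], rule jet_form_has_derivative[OF G]) (use Cons.prems in simp)
  then show ?case using Cons by (simp del: jet_form.simps)
qed simp

lemma jet_lipschitz:
  fixes G :: "('d::finite \<Rightarrow> nat) \<Rightarrow> real^'d \<Rightarrow> real"
  assumes G: "jet n G" and \<alpha>: "sum \<alpha> UNIV \<le> n"
    and C: "\<And>i x. \<bar>G (raise_index \<alpha> i) x\<bar> \<le> C"
  shows "\<bar>G \<alpha> x - G \<alpha> y\<bar> \<le> real CARD('d) * C * norm (x - y)"
proof -
  have "norm (G \<alpha> x - G \<alpha> y) \<le> (real CARD('d) * C) * norm (x - y)"
  proof (rule differentiable_bound[of UNIV "G \<alpha>" "\<lambda>x v. \<Sum>i\<in>UNIV. v $ i * G (raise_index \<alpha> i) x"])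
    fix x :: "real^'d"
    show "(G \<alpha> has_derivative (\<lambda>v. \<Sum>i\<in>UNIV. v $ i * G (raise_index \<alpha> i) x)) (at x within UNIV)"
      using G \<alpha> by (simp add: jet_def)
    show "onorm (\<lambda>v. \<Sum>i\<in>UNIV. v $ i * G (raise_index \<alpha> i) x) \<le> real CARD('d) * C"
    proof (rule onorm_le)
      fix v :: "real^'d"
      have "norm (\<Sum>i\<in>UNIV. v $ i * G (raise_index \<alpha> i) x) \<le> (\<Sum>i\<in>UNIV. \<bar>v $ i\<bar> * \<bar>G (raise_index \<alpha> i) x\<bar>)"
        by (simp add: abs_mult[symmetric] sum_abs)
      also have "\<dots> \<le> (\<Sum>i\<in>(UNIV::'d set). norm v * C)"
        by (intro sum_mono mult_mono component_le_norm_cart C) auto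
      finally show "norm (\<Sum>i\<in>UNIV. v $ i * G (raise_index \<alpha> i) x) \<le> real CARD('d) * C * norm v"
        by (simp add: mult_ac)
    qed
  qed auto
  then show ?thesis by simp
qed

lemma form_op_norm_le:
  fixes A :: "'a::euclidean_space list \<Rightarrow> real"
  assumes "\<And>vs. length vs = k \<Longrightarrow> (\<And>v. v \<in> set vs \<Longrightarrow> norm v = 1) \<Longrightarrow> \<bar>A vs\<bar> \<le> C"
  shows "form_op_norm k A \<le> C"
  unfolding form_op_norm_def
proof (rule cSUP_least)
  obtain b :: 'a where b: "b \<in> Basis" using nonempty_Basis by blast
  have "replicate k b \<in> {vs. length vs = k \<and> (\<forall>v\<in>set vs. norm v = 1)}" using b by auto
  then show "{vs::'a list. length vs = k \<and> (\<forall>v\<in>set vs. norm v = 1)} \<noteq> {}" by blast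
qed (use assms in auto)

lemma smoothness_order_bounds:
  assumes "\<beta> \<ge> 1"
  shows "real (smoothness_order \<beta>) < \<beta>" "\<beta> \<le> real (smoothness_order \<beta>) + 1"
proof -
  have bd: "k \<le> nat \<lceil>\<beta>\<rceil>" if "real k < \<beta>" for k using that by linarith
  show "real (smoothness_order \<beta>) < \<beta>" unfolding smoothness_order_def
    by (rule GreatestI_nat[of _ 0 "nat \<lceil>\<beta>\<rceil>"]) (use assms bd in auto)
  have "\<not> real (Suc (smoothness_order \<beta>)) < \<beta>"
    using Greatest_le_nat[of "\<lambda>k. real k < \<beta>" "Suc (smoothness_order \<beta>)" "nat \<lceil>\<beta>\<rceil>"] bd
    by (auto simp: smoothness_order_def)
  then show "\<beta> \<le> real (smoothness_order \<beta>) + 1" by simp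
qed

text \<open>At scale \<open>h\<close>, the Hoelder bound interpolates between the sup bound (for points at distance at
  least \<open>h\<close>) and the Lipschitz bound (for closer points).\<close>

lemma smooth_class_jetI:
  fixes f :: "real^'d::finite \<Rightarrow> real^'d" and G :: "'d \<Rightarrow> ('d \<Rightarrow> nat) \<Rightarrow> real^'d \<Rightarrow> real"
  assumes \<beta>: "\<beta> \<ge> 1" and h: "0 < h" "h \<le> 1" and a: "a \<ge> 0"
    and f: "\<And>j x. f x $ j = G j (\<lambda>_. 0) x"
    and jet: "\<And>j. jet (smoothness_order \<beta>) (G j)"
    and bound: "\<And>j \<alpha> x. sum \<alpha> UNIV \<le> Suc (smoothness_order \<beta>) \<Longrightarrow>
       \<bar>G j \<alpha> x\<bar> \<le> a * h powr (\<beta> - real (sum \<alpha> UNIV))"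
    and L: "\<And>k. k \<le> smoothness_order \<beta> \<Longrightarrow> real CARD('d) ^ k * a \<le> L k"
    and L\<beta>: "2 * real CARD('d) ^ Suc (smoothness_order \<beta>) * a \<le> L\<^sub>\<beta>"
  shows "f \<in> smooth_class \<beta> L L\<^sub>\<beta>"
proof -
  define l where "l = smoothness_order \<beta>"
  have l: "real l < \<beta>" "\<beta> \<le> real l + 1" unfolding l_def by (rule smoothness_order_bounds[OF \<beta>])+
  have fj: "(\<lambda>x. f x $ j) = G j (\<lambda>_. 0)" for j by (simp add: f fun_eq_iff)
  have df: "deriv_form (G j (\<lambda>_. 0)) vs = (\<lambda>x. jet_form (\<lambda>\<gamma>. G j \<gamma> x) vs (\<lambda>_. 0))" if "length vs \<le> Suc l" for j vs
    by (rule deriv_form_jet[OF jet]) (use that in \<open>simp add: l_def\<close>)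
  have td: "times_differentiable l (G j (\<lambda>_. 0))" for j
    unfolding times_differentiable_def
  proof (intro allI impI)
    fix vs :: "(real^'d) list" and x assume vs: "length vs < l"
    then have "((\<lambda>x. jet_form (\<lambda>\<gamma>. G j \<gamma> x) vs (\<lambda>_. 0)) has_derivative (\<lambda>v. jet_form (\<lambda>\<gamma>. G j \<gamma> x) (v # vs) (\<lambda>_. 0))) (at x)"
      by (intro jet_form_has_derivative[OF jet]) (simp add: l_def)
    then show "deriv_form (G j (\<lambda>_. 0)) vs differentiable at x"
      using vs by (subst df) (auto simp: differentiable_def)
  qed
  have bd: "form_op_norm k (\<lambda>vs. deriv_form (G j (\<lambda>_. 0)) vs x) \<le> L k" if k: "k \<le> l" for j k x
  proof (rule form_op_norm_le)
    fix vs :: "(real^'d) list" assume vs: "length vs = k" "\<And>v. v \<in> set vs \<Longrightarrow> norm v = 1"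
    have "\<bar>jet_form (\<lambda>\<gamma>. G j \<gamma> x) vs (\<lambda>_. 0)\<bar> \<le> real CARD('d) ^ length vs * a"
    proof (rule jet_form_bound[OF _ vs(2)])
      fix \<gamma> :: "'d \<Rightarrow> nat" assume "sum \<gamma> UNIV = sum (\<lambda>_. 0) (UNIV :: 'd set) + length vs"
      then have \<gamma>: "sum \<gamma> UNIV = k" using vs by simp
      have "\<bar>G j \<gamma> x\<bar> \<le> a * h powr (\<beta> - real k)" using bound[of \<gamma> j x] \<gamma> k by (simp add: l_def)
      also have "h powr (\<beta> - real k) \<le> 1" using h l k by (intro powr_le1) auto
      finally show "\<bar>G j \<gamma> x\<bar> \<le> a" using a by (simp add: mult_left_mono)
    qed
    also have "\<dots> \<le> L k" using L[of k] k vs by (simp add: l_def)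
    finally show "\<bar>deriv_form (G j (\<lambda>_. 0)) vs x\<bar> \<le> L k" using vs k by (simp add: df)
  qed
  have hd: "form_op_norm l (\<lambda>vs. deriv_form (G j (\<lambda>_. 0)) vs x - deriv_form (G j (\<lambda>_. 0)) vs y)
      \<le> L\<^sub>\<beta> * norm (x - y) powr (\<beta> - real l)" for j x y
  proof (rule form_op_norm_le)
    fix vs :: "(real^'d) list" assume vs: "length vs = l" "\<And>v. v \<in> set vs \<Longrightarrow> norm v = 1"
    let ?d = "real CARD('d)" and ?r = "norm (x - y)"
    have d1: "?d \<ge> 1" by simp
    \<comment> \<open>The factor \<open>2 * ?d\<close> covers both regimes: 2 from the triangle
      inequality at distance at least \<open>h\<close>, \<open>?d\<close> from the gradient at
      smaller distance.\<close>
    have "\<bar>jet_form (\<lambda>\<gamma>. G j \<gamma> x - G j \<gamma> y) vs (\<lambda>_. 0)\<bar> \<le> ?d ^ length vs * (2 * ?d * a * ?r powr (\<beta> - l))"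
    proof (rule jet_form_bound[OF _ vs(2)])
      fix \<gamma> :: "'d \<Rightarrow> nat" assume "sum \<gamma> UNIV = sum (\<lambda>_. 0) (UNIV :: 'd set) + length vs"
      then have \<gamma>: "sum \<gamma> UNIV = l" using vs by simp
      show "\<bar>G j \<gamma> x - G j \<gamma> y\<bar> \<le> 2 * ?d * a * ?r powr (\<beta> - l)"
      proof (cases "?r \<ge> h")
        case True
        have "\<bar>G j \<gamma> z\<bar> \<le> a * ?r powr (\<beta> - l)" for z
        proof -
          have "\<bar>G j \<gamma> z\<bar> \<le> a * h powr (\<beta> - l)" using bound[of \<gamma> j z] \<gamma> by (simp add: l_def)
          also have "\<dots> \<le> a * ?r powr (\<beta> - l)"
            using True h l a by (intro mult_left_mono powr_mono2) auto
          finally show ?thesis .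
        qed
        from this[of x] this[of y] have "\<bar>G j \<gamma> x - G j \<gamma> y\<bar> \<le> 1 * (2 * a * ?r powr (\<beta> - l))" by simp
        also have "\<dots> \<le> ?d * (2 * a * ?r powr (\<beta> - l))" using a d1 by (intro mult_right_mono) auto
        finally show ?thesis by (simp add: mult_ac)
      next
        case False
        show ?thesis
        proof (cases "x = y")
          case neq: False
          then have r: "0 < ?r" "?r < h" using False by auto
          have "\<bar>G j \<gamma> x - G j \<gamma> y\<bar> \<le> ?d * (a * h powr (\<beta> - (l + 1))) * ?r"
          proof (rule jet_lipschitz[OF jet])
            show "\<bar>G j (raise_index \<gamma> i) z\<bar> \<le> a * h powr (\<beta> - (l + 1))" for i z
              using bound[of "raise_index \<gamma> i" j z] \<gamma> by (simp add: l_def add.commute)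
          qed (use \<gamma> l_def in auto)
          also have "\<dots> = ?d * a * (h powr (\<beta> - (l + 1)) * ?r powr 1)" using r by simp
          also have "\<dots> \<le> ?d * a * ?r powr (\<beta> - l)"
          proof (intro mult_left_mono)
            \<comment> \<open>The exponent \<beta> - (l + 1) is at most 0, so passing from
              \<open>h\<close> to the smaller \<open>?r\<close> can only increase the power.\<close>
            have "h powr (\<beta> - (l + 1)) \<le> ?r powr (\<beta> - (l + 1))"
              using r l by (intro powr_mono2') auto
            then have "h powr (\<beta> - (l + 1)) * ?r powr 1 \<le> ?r powr (\<beta> - (l + 1)) * ?r powr 1"
              by (rule mult_right_mono) simp
            also have "\<dots> = ?r powr (\<beta> - l)" by (subst powr_add[symmetric]) simp
            finally show "h powr (\<beta> - (l + 1)) * ?r powr 1 \<le> ?r powr (\<beta> - l)" .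
          qed (use a in auto)
          also have "\<dots> \<le> 2 * (?d * a * ?r powr (\<beta> - l))" using a by simp
          finally show ?thesis by (simp add: mult_ac)
        qed simp
      qed
    qed
    also have "\<dots> = (2 * ?d ^ Suc l * a) * ?r powr (\<beta> - l)" using vs by (simp add: mult_ac)
    also have "\<dots> \<le> L\<^sub>\<beta> * ?r powr (\<beta> - l)" using L\<beta> by (intro mult_right_mono) (auto simp: l_def)
    finally show "\<bar>deriv_form (G j (\<lambda>_. 0)) vs x - deriv_form (G j (\<lambda>_. 0)) vs y\<bar>
        \<le> L\<^sub>\<beta> * ?r powr (\<beta> - real l)" using vs by (simp add: df jet_form_diff)
  qed
  define D where "D g \<longleftrightarrow> times_differentiable l g \<and>
     (\<forall>k\<le>l. \<forall>x. form_op_norm k (\<lambda>vs. deriv_form g vs x) \<le> L k) \<and>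
     (\<forall>x x'. form_op_norm l (\<lambda>vs. deriv_form g vs x - deriv_form g vs x')
               \<le> L\<^sub>\<beta> * norm (x - x') powr (\<beta> - real l))" for g :: "real^'d \<Rightarrow> real"
  have "D (\<lambda>x. f x $ j)" for j
    unfolding fj[of j] D_def using td bd hd by blast
  then show ?thesis by (simp add: smooth_class_def D_def Let_def l_def)
qed

section \<open>Sums of disjoint bumps\<close>

definition separated :: "real \<Rightarrow> 'k set \<Rightarrow> ('k \<Rightarrow> real^'d) \<Rightarrow> bool" where
  "separated h K z \<longleftrightarrow> (\<forall>\<kappa>\<in>K. \<forall>\<kappa>'\<in>K. \<kappa> \<noteq> \<kappa>' \<longrightarrow> (\<exists>i. \<bar>z \<kappa> $ i - z \<kappa>' $ i\<bar> \<ge> 2 * h))"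

lemma norm_axis: "norm (axis i a :: real^'d::finite) = \<bar>a\<bar>"
  by (simp add: norm_eq_sqrt_inner inner_axis_axis)

context bump_profile
begin

text \<open>The index \<open>\<alpha>\<close> selects a mixed partial derivative of a product bump;
  it is again a product, with a factor 1/h for each differentiation. The bump itself has the zero
  index.\<close>

definition bump :: "real \<Rightarrow> real^'d::finite \<Rightarrow> ('d \<Rightarrow> nat) \<Rightarrow> real^'d \<Rightarrow> real" where
  "bump h w \<alpha> x = (\<Prod>i\<in>UNIV. \<psi> (\<alpha> i) ((x $ i - w $ i) / h) / h ^ \<alpha> i)"

definition bump_field ::
    "real \<Rightarrow> real \<Rightarrow> 'k set \<Rightarrow> ('k \<Rightarrow> real^'d::finite) \<Rightarrow> 'd \<Rightarrow> ('k \<Rightarrow> real) \<Rightarrow> real^'d \<Rightarrow> real^'d" where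
  "bump_field A h K z i\<^sub>0 \<theta> x = axis i\<^sub>0 (A * (\<Sum>\<kappa>\<in>K. \<theta> \<kappa> * bump h (z \<kappa>) (\<lambda>_. 0) x))"

lemma multi_index_le:
  fixes \<alpha> :: "'d::finite \<Rightarrow> nat"
  shows "\<alpha> i \<le> sum \<alpha> UNIV"
  by (rule member_le_sum) auto

lemma bump_has_derivative:
  fixes w x :: "real^'d::finite"
  assumes "sum \<alpha> UNIV \<le> n" and h: "h > 0"
  shows "(bump h w \<alpha> has_derivative (\<lambda>v. \<Sum>i\<in>UNIV. v $ i * bump h w (raise_index \<alpha> i) x)) (at x)"
proof -
  have \<alpha>: "\<alpha> i \<le> n" for i using multi_index_le[of \<alpha> i] assms by simp
  have one: "((\<lambda>x. \<psi> (\<alpha> i) ((x $ i - w $ i) / h) / h ^ \<alpha> i) has_derivative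
     (\<lambda>v. v $ i * (\<psi> (Suc (\<alpha> i)) ((x $ i - w $ i) / h) / h ^ Suc (\<alpha> i)))) (at x)" for i
  proof -
    have "((\<lambda>x. (x $ i - w $ i) / h) has_derivative (\<lambda>v. v $ i / h)) (at x)"
      using h by (auto intro!: derivative_eq_intros bounded_linear.has_derivative[OF bounded_linear_vec_nth])
    from has_derivative_compose[OF this \<psi>_deriv[OF \<alpha>[of i], unfolded has_field_derivative_def]]
    have "((\<lambda>x. \<psi> (\<alpha> i) ((x $ i - w $ i) / h)) has_derivative
       (\<lambda>v. \<psi> (Suc (\<alpha> i)) ((x $ i - w $ i) / h) * (v $ i / h))) (at x)" .
    from has_derivative_divide'[OF this has_derivative_const[of "h ^ \<alpha> i"]] h
    show ?thesis by (simp add: field_simps)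
  qed
  have "(bump h w \<alpha> has_derivative (\<lambda>v. \<Sum>i\<in>UNIV. (v $ i * (\<psi> (Suc (\<alpha> i)) ((x $ i - w $ i) / h) / h ^ Suc (\<alpha> i)))
      * (\<Prod>j\<in>UNIV - {i}. \<psi> (\<alpha> j) ((x $ j - w $ j) / h) / h ^ \<alpha> j))) (at x)"
    unfolding bump_def[abs_def] by (rule has_derivative_prod[OF one])
  moreover have "bump h w (raise_index \<alpha> i) x = (\<psi> (Suc (\<alpha> i)) ((x $ i - w $ i) / h) / h ^ Suc (\<alpha> i))
      * (\<Prod>j\<in>UNIV - {i}. \<psi> (\<alpha> j) ((x $ j - w $ j) / h) / h ^ \<alpha> j)" for i
    unfolding bump_def by (subst prod.remove[of _ i]) (auto simp: raise_index_def)
  ultimately show ?thesis by (simp add: mult.assoc)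
qed

lemma bump_bound:
  fixes w x :: "real^'d::finite"
  assumes "sum \<alpha> UNIV \<le> Suc n" and h: "h > 0"
  shows "\<bar>bump h w \<alpha> x\<bar> \<le> B ^ CARD('d) / h ^ sum \<alpha> UNIV"
proof -
  have \<alpha>: "\<alpha> i \<le> Suc n" for i using multi_index_le[of \<alpha> i] assms by simp
  have "\<bar>bump h w \<alpha> x\<bar> = (\<Prod>i\<in>UNIV. \<bar>\<psi> (\<alpha> i) ((x $ i - w $ i) / h)\<bar>) / h ^ sum \<alpha> UNIV"
    using h by (simp add: bump_def abs_prod prod_dividef power_sum)
  also have "\<dots> \<le> (\<Prod>i\<in>(UNIV::'d set). B) / h ^ sum \<alpha> UNIV"
    using h \<psi>_bound[OF \<alpha>] by (intro divide_right_mono prod_mono) auto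
  finally show ?thesis by simp
qed

lemma bump_eq_0:
  assumes "sum \<alpha> UNIV \<le> Suc n" and h: "h > 0" and "\<bar>x $ i - w $ i\<bar> \<ge> h"
  shows "bump h w \<alpha> x = 0"
proof -
  have "\<alpha> i \<le> Suc n" using multi_index_le[of \<alpha> i] assms by simp
  from \<psi>_outside[OF this, of "(x $ i - w $ i) / h"] assms show ?thesis
    by (auto simp: bump_def field_simps)
qed

lemma bump_0: "bump h w (\<lambda>_. 0) x \<ge> 0" "bump h w (\<lambda>_. 0) x \<le> 1" "bump h w (\<lambda>_. 0) w = 1"
  by (auto simp: bump_def \<psi>_0 intro!: prod_nonneg prod_le_1)

lemma bump_lower:
  fixes w x :: "real^'d::finite"
  assumes "h > 0" and "\<And>i. \<bar>x $ i - w $ i\<bar> \<le> h / 2"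
  shows "bump h w (\<lambda>_. 0) x \<ge> c ^ CARD('d)"
proof -
  have "(\<Prod>i\<in>(UNIV::'d set). c) \<le> (\<Prod>i\<in>(UNIV::'d set). \<psi> 0 ((x $ i - w $ i) / h))"
    using c_pos assms by (intro prod_mono conjI \<psi>_lower) (auto simp: field_simps)
  then show ?thesis by (simp add: bump_def)
qed

text \<open>Centres at distance 2 h in the maximum norm have disjoint open cubes of half-width h,
  and the derivatives of a bump up to order n + 1 vanish outside its cube. So a point sees at most
  one summand.\<close>

lemma separated_sum_bump:
  assumes K: "finite K" "separated h K z" and h: "h > 0" and \<alpha>: "sum \<alpha> UNIV \<le> Suc n"
    and \<kappa>: "\<kappa> \<in> K" "\<And>i. \<bar>x $ i - z \<kappa> $ i\<bar> < h"
  shows "(\<Sum>\<kappa>\<in>K. \<theta> \<kappa> * bump h (z \<kappa>) \<alpha> x) = \<theta> \<kappa> * bump h (z \<kappa>) \<alpha> x"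
proof -
  have "bump h (z \<kappa>') \<alpha> x = 0" if \<kappa>': "\<kappa>' \<in> K - {\<kappa>}" for \<kappa>'
  proof -
    from K(2) \<kappa>(1) \<kappa>' obtain i where "\<bar>z \<kappa> $ i - z \<kappa>' $ i\<bar> \<ge> 2 * h"
      unfolding separated_def by (metis DiffE singletonI)
    with \<kappa>(2)[of i] show ?thesis by (intro bump_eq_0[OF \<alpha> h, of _ i]) linarith
  qed
  then show ?thesis by (subst sum.remove[OF K(1) \<kappa>(1)]) (simp add: sum.neutral)
qed

text \<open>At each point at most one term survives, so the bound of a single bump holds for the
  sum, and the size of the family never enters the smoothness constants.\<close>

lemma separated_sum_bump_bound:
  assumes K: "finite K" "separated h K z" and h: "h > 0" and \<alpha>: "sum \<alpha> UNIV \<le> Suc n"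
    and \<theta>: "\<And>\<kappa>. \<kappa> \<in> K \<Longrightarrow> \<bar>\<theta> \<kappa>\<bar> \<le> 1" and b: "\<And>w. \<bar>bump h w \<alpha> x\<bar> \<le> b"
  shows "\<bar>\<Sum>\<kappa>\<in>K. \<theta> \<kappa> * bump h (z \<kappa>) \<alpha> x\<bar> \<le> b"
proof (cases "\<exists>\<kappa>\<in>K. \<forall>i. \<bar>x $ i - z \<kappa> $ i\<bar> < h")
  case True
  then obtain \<kappa> where \<kappa>: "\<kappa> \<in> K" "\<And>i. \<bar>x $ i - z \<kappa> $ i\<bar> < h" by auto
  have "\<bar>\<theta> \<kappa> * bump h (z \<kappa>) \<alpha> x\<bar> \<le> 1 * b"
    unfolding abs_mult by (intro mult_mono \<theta> \<kappa> b) auto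
  then show ?thesis by (simp add: separated_sum_bump[OF K h \<alpha> \<kappa>])
next
  case False
  then have "(\<Sum>\<kappa>\<in>K. \<theta> \<kappa> * bump h (z \<kappa>) \<alpha> x) = 0"
    by (intro sum.neutral) (auto simp: not_less intro: bump_eq_0[OF \<alpha> h])
  then show ?thesis using b[of 0] by simp
qed

lemma jet_bump_sum:
  fixes z :: "'k \<Rightarrow> real^'d::finite"
  assumes "h > 0"
  shows "jet n (\<lambda>\<alpha> x. A * (\<Sum>\<kappa>\<in>K. \<theta> \<kappa> * bump h (z \<kappa>) \<alpha> x))"
  unfolding jet_def
proof (intro allI impI)
  fix \<alpha> :: "'d \<Rightarrow> nat" and x :: "real^'d" assume \<alpha>: "sum \<alpha> UNIV \<le> n"
  have "((\<lambda>x. A * (\<Sum>\<kappa>\<in>K. \<theta> \<kappa> * bump h (z \<kappa>) \<alpha> x)) has_derivative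
     (\<lambda>v. A * (\<Sum>\<kappa>\<in>K. \<theta> \<kappa> * (\<Sum>i\<in>UNIV. v $ i * bump h (z \<kappa>) (raise_index \<alpha> i) x)))) (at x)"
    by (intro has_derivative_mult_right has_derivative_sum bump_has_derivative \<alpha> assms)
  moreover have "A * (\<Sum>\<kappa>\<in>K. \<theta> \<kappa> * (\<Sum>i\<in>UNIV. v $ i * bump h (z \<kappa>) (raise_index \<alpha> i) x))
     = (\<Sum>i\<in>UNIV. v $ i * (A * (\<Sum>\<kappa>\<in>K. \<theta> \<kappa> * bump h (z \<kappa>) (raise_index \<alpha> i) x)))" for v
    by (simp add: sum_distrib_left mult.left_commute) (rule sum.swap)
  ultimately show "((\<lambda>x. A * (\<Sum>\<kappa>\<in>K. \<theta> \<kappa> * bump h (z \<kappa>) \<alpha> x)) has_derivative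
     (\<lambda>v. \<Sum>i\<in>UNIV. v $ i * (A * (\<Sum>\<kappa>\<in>K. \<theta> \<kappa> * bump h (z \<kappa>) (raise_index \<alpha> i) x)))) (at x)"
    by simp
qed

context
  fixes h :: real and K :: "'k set" and z :: "'k \<Rightarrow> real^'d::finite" and \<theta> :: "'k \<Rightarrow> real"
  assumes h: "h > 0" and K: "finite K" "separated h K z"
    and \<theta>: "\<And>\<kappa>. \<kappa> \<in> K \<Longrightarrow> 0 \<le> \<theta> \<kappa> \<and> \<theta> \<kappa> \<le> 1"
begin

text \<open>A derivative of order k of a bump of width h has size h^-k, so the height a h^\<beta>
  leaves a h^(\<beta> - k). This is the scaling asked for by \<open>smooth_class_jetI\<close>, with
  \<open>a\<close> enlarged by \<open>B ^ CARD('d)\<close>.\<close>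

lemma bump_field_smooth:
  assumes \<beta>: "\<beta> \<ge> 1" and n: "n = smoothness_order \<beta>" and h1: "h \<le> 1" and a: "a \<ge> 0"
    and L: "\<And>k. k \<le> smoothness_order \<beta> \<Longrightarrow> real CARD('d) ^ k * (a * B ^ CARD('d)) \<le> L k"
    and L\<beta>: "2 * real CARD('d) ^ Suc (smoothness_order \<beta>) * (a * B ^ CARD('d)) \<le> L\<^sub>\<beta>"
  shows "bump_field (a * h powr \<beta>) h K z i\<^sub>0 \<theta> \<in> smooth_class \<beta> L L\<^sub>\<beta>"
proof (rule smooth_class_jetI[OF \<beta> h h1 _ _ _ _ L L\<beta>])
  let ?G = "\<lambda>j \<alpha> x. (if j = i\<^sub>0 then a * h powr \<beta> else 0) * (\<Sum>\<kappa>\<in>K. \<theta> \<kappa> * bump h (z \<kappa>) \<alpha> x)"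
  show "a * B ^ CARD('d) \<ge> 0" using a B_ge_1 by simp
  show "bump_field (a * h powr \<beta>) h K z i\<^sub>0 \<theta> x $ j = ?G j (\<lambda>_. 0) x" for j x
    by (simp add: bump_field_def axis_def)
  show "jet (smoothness_order \<beta>) (?G j)" for j
    using jet_bump_sum[OF h] unfolding n by blast
  fix j and \<alpha> :: "'d \<Rightarrow> nat" and x :: "real^'d" assume \<alpha>: "sum \<alpha> UNIV \<le> Suc (smoothness_order \<beta>)"
  let ?k = "sum \<alpha> UNIV"
  have "\<bar>\<Sum>\<kappa>\<in>K. \<theta> \<kappa> * bump h (z \<kappa>) \<alpha> x\<bar> \<le> B ^ CARD('d) / h ^ ?k"
    using \<alpha> \<theta> n h K by (intro separated_sum_bump_bound bump_bound) auto
  then have "\<bar>?G j \<alpha> x\<bar> \<le> (a * h powr \<beta>) * (B ^ CARD('d) / h ^ ?k)"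
    using a B_ge_1 h unfolding abs_mult by (intro mult_mono) auto
  also have "\<dots> = a * B ^ CARD('d) * h powr (\<beta> - real ?k)"
    using h by (simp add: powr_diff powr_realpow del: of_nat_sum)
  finally show "\<bar>?G j \<alpha> x\<bar> \<le> a * B ^ CARD('d) * h powr (\<beta> - real ?k)" .
qed

lemma norm_bump_field_le:
  assumes "A \<ge> 0" shows "norm (bump_field A h K z i\<^sub>0 \<theta> x) \<le> A"
proof -
  have "\<bar>\<Sum>\<kappa>\<in>K. \<theta> \<kappa> * bump h (z \<kappa>) (\<lambda>_. 0) x\<bar> \<le> 1"
    using h K \<theta> by (intro separated_sum_bump_bound) (auto simp: abs_of_nonneg[OF bump_0(1)] bump_0(2))
  from mult_left_mono[OF this assms] assms show ?thesis
    by (simp add: bump_field_def norm_axis abs_mult)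
qed

lemma bump_field_eq:
  assumes "\<kappa> \<in> K" "\<And>i. \<bar>x $ i - z \<kappa> $ i\<bar> < h"
  shows "bump_field A h K z i\<^sub>0 \<theta> x = axis i\<^sub>0 (A * (\<theta> \<kappa> * bump h (z \<kappa>) (\<lambda>_. 0) x))"
  unfolding bump_field_def by (subst separated_sum_bump[OF K h _ assms]) auto

lemma bump_field_eq_0:
  assumes "\<And>\<kappa>. \<kappa> \<in> K \<Longrightarrow> \<theta> \<kappa> \<noteq> 0 \<Longrightarrow> \<exists>i. \<bar>x $ i - z \<kappa> $ i\<bar> \<ge> h"
  shows "bump_field A h K z i\<^sub>0 \<theta> x = 0"
proof -
  have "(\<Sum>\<kappa>\<in>K. \<theta> \<kappa> * bump h (z \<kappa>) (\<lambda>_. 0) x) = 0"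
  proof (intro sum.neutral ballI)
    fix \<kappa> assume "\<kappa> \<in> K"
    then show "\<theta> \<kappa> * bump h (z \<kappa>) (\<lambda>_. 0) x = 0"
      using assms[of \<kappa>] bump_eq_0[OF _ h, of "\<lambda>_. 0" x _ "z \<kappa>"] by (cases "\<theta> \<kappa> = 0") auto
  qed
  then show ?thesis by (simp add: bump_field_def axis_def vec_eq_iff)
qed

lemma bump_field_lipschitz:
  assumes A: "A \<ge> 0"
  obtains \<Lambda> where "\<Lambda> > 0"
    "\<And>x y. norm (bump_field A h K z i\<^sub>0 \<theta> x - bump_field A h K z i\<^sub>0 \<theta> y) \<le> \<Lambda> * norm (x - y)"
proof
  let ?G = "\<lambda>\<alpha> x. A * (\<Sum>\<kappa>\<in>K. \<theta> \<kappa> * bump h (z \<kappa>) \<alpha> x)"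
  let ?C = "A * (B ^ CARD('d) / h)"
  have C: "?C \<ge> 0" using A B_ge_1 h by simp
  \<comment> \<open>The summand 1 keeps the constant positive when \<open>A = 0\<close>.\<close>
  show "real CARD('d) * ?C + 1 > 0" using mult_nonneg_nonneg[OF of_nat_0_le_iff C, of "CARD('d)"] by linarith
  fix x y
  have "\<bar>?G (\<lambda>_. 0) x - ?G (\<lambda>_. 0) y\<bar> \<le> real CARD('d) * ?C * norm (x - y)"
  proof (rule jet_lipschitz[OF jet_bump_sum[OF h]])
    fix i and x :: "real^'d"
    have "\<bar>\<Sum>\<kappa>\<in>K. \<theta> \<kappa> * bump h (z \<kappa>) (raise_index (\<lambda>_. 0) i) x\<bar> \<le> B ^ CARD('d) / h ^ sum (raise_index (\<lambda>_. 0) i) (UNIV :: 'd set)"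
      using h K \<theta> by (intro separated_sum_bump_bound bump_bound) auto
    from mult_left_mono[OF this A] A show "\<bar>?G (raise_index (\<lambda>_. 0) i) x\<bar> \<le> ?C" by (simp add: abs_mult)
  qed simp
  then have "norm (axis i\<^sub>0 (?G (\<lambda>_. 0) x - ?G (\<lambda>_. 0) y) :: real^'d) \<le> real CARD('d) * ?C * norm (x - y)"
    by (simp add: norm_axis)
  also have "axis i\<^sub>0 (?G (\<lambda>_. 0) x - ?G (\<lambda>_. 0) y) = bump_field A h K z i\<^sub>0 \<theta> x - bump_field A h K z i\<^sub>0 \<theta> y"
    by (simp add: bump_field_def axis_def vec_eq_iff)
  finally show "norm (bump_field A h K z i\<^sub>0 \<theta> x - bump_field A h K z i\<^sub>0 \<theta> y) \<le> (real CARD('d) * ?C + 1) * norm (x - y)"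
    by (simp add: distrib_right) (smt (verit) norm_ge_zero)
qed

text \<open>Only trajectories that start in the support of the field move at all; \<open>cover_condition\<close> bounds
  their number.\<close>

lemma bump_field_divergence:
  assumes design: "observation_design m n\<^sub>o T t" and cover: "cover_condition C\<^sub>c\<^sub>v\<^sub>r m x"
    and A: "A \<ge> 0" and C: "C \<ge> 0" and z: "\<And>\<kappa>. \<kappa> \<in> K \<Longrightarrow> z \<kappa> \<in> unit_cube"
  defines "n_max \<equiv> real (Max (n\<^sub>o ` {1..m}))" and "T_max \<equiv> Max (T ` {1..m})"
  shows "(\<Sum>(j, i)\<in>obs_index m n\<^sub>o. C * (norm (flow (bump_field A h K z i\<^sub>0 \<theta>) (x j) (t j i)
            - flow (\<lambda>_. 0) (x j) (t j i)))\<^sup>2)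
    \<le> real (card {\<kappa>\<in>K. \<theta> \<kappa> \<noteq> 0}) * max 1 (real m * C\<^sub>c\<^sub>v\<^sub>r * (real CARD('d) * h) ^ CARD('d))
        * (C * n_max * T_max\<^sup>2 * A\<^sup>2)"
proof -
  let ?f = "bump_field A h K z i\<^sub>0 \<theta>"
  let ?r = "real CARD('d) * h"
  let ?K = "{\<kappa>\<in>K. \<theta> \<kappa> \<noteq> 0}"
  let ?R = "max 1 (real m * C\<^sub>c\<^sub>v\<^sub>r * ?r ^ CARD('d))"
  let ?J = "{j\<in>{1..m}. ?f (x j) \<noteq> 0}"
  obtain \<Lambda> where \<Lambda>: "\<Lambda> > 0" "\<And>x y. norm (?f x - ?f y) \<le> \<Lambda> * norm (x - y)"
    using bump_field_lipschitz[OF A, of i\<^sub>0] by metis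
  have m: "m \<ge> 1" using design by (simp add: observation_design_def)
  have f0: "flow (\<lambda>_. 0) y s = y" for y :: "real^'d" and s
    by (rule flow_stationary[of _ 1]) auto
  have tbd: "0 \<le> t j i \<and> t j i \<le> T_max" if "j \<in> {1..m}" "i \<in> {1..n\<^sub>o j}" for j i
  proof -
    have mono: "t j i \<le> t j k" if "i \<le> k" "k \<le> n\<^sub>o j" for i k
      using that
    proof (induction k rule: dec_induct)
      case (step k)
      have "t j k \<le> t j (Suc k)" using design \<open>j \<in> {1..m}\<close> step by (simp add: observation_design_def)
      with step show ?case by simp
    qed simp
    have "t j 0 = 0" "t j (n\<^sub>o j) = T j" using design that by (auto simp: observation_design_def)
    moreover have "T j \<le> T_max" unfolding T_max_def using that by (intro Max_ge) auto
    ultimately show ?thesis using mono[of 0 i] mono[of i "n\<^sub>o j"] that by auto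
  qed
  have displ: "C * (norm (flow ?f (x j) (t j i) - flow (\<lambda>_. 0) (x j) (t j i)))\<^sup>2
      \<le> (if ?f (x j) = 0 then 0 else C * T_max\<^sup>2 * A\<^sup>2)" if "j \<in> {1..m}" "i \<in> {1..n\<^sub>o j}" for j i
  proof (cases "?f (x j) = 0")
    case True
    then show ?thesis using flow_stationary[OF \<Lambda>(2,1) True] by (simp add: f0)
  next
    case False
    have "norm (flow ?f (x j) (t j i) - x j) \<le> A * t j i"
      by (rule flow_displacement[OF \<Lambda>(2,1) norm_bump_field_le[OF A]]) (use tbd[OF that] in auto)
    also have "\<dots> \<le> A * T_max" using tbd[OF that] A by (intro mult_left_mono) auto
    finally have "(norm (flow ?f (x j) (t j i) - x j))\<^sup>2 \<le> (A * T_max)\<^sup>2" by (intro power_mono) auto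
    from mult_left_mono[OF this C] False show ?thesis by (simp add: f0 power_mult_distrib mult_ac)
  qed
  have card_one: "real (card {j\<in>{1..m}. norm (x j - z \<kappa>) < ?r}) \<le> ?R" if "\<kappa> \<in> K" for \<kappa>
  proof -
    have "?r > 0" using h by simp
    then have "real (card {j\<in>{1..m}. norm (x j - z \<kappa>) < ?r}) / real m \<le> max (1 / real m) (C\<^sub>c\<^sub>v\<^sub>r * ?r ^ CARD('d))"
      using cover z[OF that] unfolding cover_condition_def by blast
    then have "real (card {j\<in>{1..m}. norm (x j - z \<kappa>) < ?r}) \<le> max (1 / real m) (C\<^sub>c\<^sub>v\<^sub>r * ?r ^ CARD('d)) * real m"
      using m by (simp add: pos_divide_le_eq)
    also have "\<dots> = ?R" using m by (subst max_mult_distrib_right) (simp add: mult_ac)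
    finally show ?thesis .
  qed
  have "?J \<subseteq> (\<Union>\<kappa>\<in>?K. {j\<in>{1..m}. norm (x j - z \<kappa>) < ?r})"
  proof
    fix j assume j: "j \<in> ?J"
    then have "\<not> (\<forall>\<kappa>\<in>K. \<theta> \<kappa> \<noteq> 0 \<longrightarrow> (\<exists>i. \<bar>x j $ i - z \<kappa> $ i\<bar> \<ge> h))"
      using bump_field_eq_0[of "x j" A i\<^sub>0] by blast
    then obtain \<kappa> where \<kappa>: "\<kappa> \<in> ?K" "\<And>i. \<bar>x j $ i - z \<kappa> $ i\<bar> < h"
      by (auto simp: not_le)
    \<comment> \<open>Through the l^1 norm, the open cube of half-width \<open>h\<close> lies in the
      open ball of radius \<open>?r\<close>; the strict inequality matches
      \<open>cover_condition\<close>.\<close>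
    have "norm (x j - z \<kappa>) \<le> (\<Sum>i\<in>UNIV. \<bar>(x j - z \<kappa>) $ i\<bar>)" by (rule norm_le_l1_cart)
    also have "\<dots> < (\<Sum>i\<in>(UNIV::'d set). h)" by (rule sum_strict_mono) (use \<kappa> in auto)
    finally have "norm (x j - z \<kappa>) < ?r" by simp
    with \<kappa> j show "j \<in> (\<Union>\<kappa>\<in>?K. {j\<in>{1..m}. norm (x j - z \<kappa>) < ?r})" by blast
  qed
  then have "card ?J \<le> card (\<Union>\<kappa>\<in>?K. {j\<in>{1..m}. norm (x j - z \<kappa>) < ?r})"
    using K by (intro card_mono) auto
  also have "\<dots> \<le> (\<Sum>\<kappa>\<in>?K. card {j\<in>{1..m}. norm (x j - z \<kappa>) < ?r})"
    using K by (intro card_UN_le) auto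
  finally have "real (card ?J) \<le> (\<Sum>\<kappa>\<in>?K. real (card {j\<in>{1..m}. norm (x j - z \<kappa>) < ?r}))"
    by (simp flip: of_nat_sum)
  also have "\<dots> \<le> (\<Sum>\<kappa>\<in>?K. ?R)" by (intro sum_mono card_one) auto
  finally have J: "real (card ?J) \<le> real (card ?K) * ?R" by simp
  have "(\<Sum>(j, i)\<in>obs_index m n\<^sub>o. C * (norm (flow ?f (x j) (t j i) - flow (\<lambda>_. 0) (x j) (t j i)))\<^sup>2)
      = (\<Sum>j\<in>{1..m}. \<Sum>i\<in>{1..n\<^sub>o j}. C * (norm (flow ?f (x j) (t j i) - flow (\<lambda>_. 0) (x j) (t j i)))\<^sup>2)"
    unfolding obs_index_def by (subst sum.Sigma) auto
  also have "\<dots> \<le> (\<Sum>j\<in>{1..m}. \<Sum>i\<in>{1..n\<^sub>o j}. (if ?f (x j) = 0 then 0 else C * T_max\<^sup>2 * A\<^sup>2))"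
    by (intro sum_mono displ)
  also have "\<dots> \<le> (\<Sum>j\<in>{1..m}. if ?f (x j) = 0 then 0 else n_max * (C * T_max\<^sup>2 * A\<^sup>2))"
  proof (intro sum_mono)
    fix j assume "j \<in> {1..m}"
    then have "real (n\<^sub>o j) \<le> n_max" by (auto simp: n_max_def intro!: Max_ge)
    then show "(\<Sum>i\<in>{1..n\<^sub>o j}. if ?f (x j) = 0 then 0 else C * T_max\<^sup>2 * A\<^sup>2)
        \<le> (if ?f (x j) = 0 then 0 else n_max * (C * T_max\<^sup>2 * A\<^sup>2))"
      using C by (auto intro: mult_right_mono)
  qed
  also have "\<dots> = (\<Sum>j\<in>?J. n_max * (C * T_max\<^sup>2 * A\<^sup>2))"
    by (subst sum.inter_filter) (auto intro!: sum.cong)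
  also have "\<dots> = real (card ?J) * (C * n_max * T_max\<^sup>2 * A\<^sup>2)" by (simp add: mult_ac)
  also have "\<dots> \<le> real (card ?K) * ?R * (C * n_max * T_max\<^sup>2 * A\<^sup>2)"
    using C by (intro mult_right_mono[OF J]) (auto simp: n_max_def)
  finally show ?thesis .
qed

end

end

section \<open>Entropy, norms and bandwidth\<close>

text \<open>Chernoff's argument with weights \<open>(1 / 2) ^ card (sym_diff S S\<^sub>0)\<close>: a
  member of the ball weighs at least \<open>2 powr (- (card K / 8))\<close>, while the weights of
  all subsets sum to (1 + 1/2) to the power \<open>card K\<close>, because taking the symmetric
  difference with \<open>S\<^sub>0\<close> permutes the subsets.\<close>

lemma card_hamming_ball:
  assumes K: "finite K" and S0: "S\<^sub>0 \<subseteq> K"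
  shows "real (card {S\<in>Pow K. 8 * card (sym_diff S S\<^sub>0) \<le> card K})
     \<le> (3 / 2) ^ card K * 2 powr (card K / 8)"
proof -
  let ?U = "{S\<in>Pow K. 8 * card (sym_diff S S\<^sub>0) \<le> card K}"
  have "(\<Sum>S\<in>?U. 2 powr (- (card K / 8))) \<le> (\<Sum>S\<in>?U. (1 / 2) ^ card (sym_diff S S\<^sub>0))"
  proof (rule sum_mono)
    fix S assume "S \<in> ?U"
    then have "- (card K / 8) \<le> - real (card (sym_diff S S\<^sub>0))" by simp
    then have "2 powr (- (card K / 8)) \<le> 2 powr (- real (card (sym_diff S S\<^sub>0)))"
      by (intro powr_mono) auto
    also have "\<dots> = (1 / 2) ^ card (sym_diff S S\<^sub>0)"
      by (simp add: powr_minus powr_realpow power_one_over inverse_eq_divide)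
    finally show "2 powr (- (card K / 8)) \<le> (1 / 2) ^ card (sym_diff S S\<^sub>0)" .
  qed
  also have "\<dots> \<le> (\<Sum>S\<in>Pow K. (1 / 2) ^ card (sym_diff S S\<^sub>0))"
    using K by (intro sum_mono2) auto
  also have "\<dots> = (\<Sum>S\<in>Pow K. (1 / 2 :: real) ^ card S)"
    by (rule sum.reindex_bij_witness[of _ "\<lambda>S. sym_diff S S\<^sub>0" "\<lambda>S. sym_diff S S\<^sub>0"])
      (use S0 in \<open>auto\<close>)
  also have "\<dots> = (\<Prod>x\<in>K. 1 / 2 + 1)"
    by (subst prod_add[OF K]) auto
  also have "\<dots> = (3 / 2) ^ card K" by simp
  finally have "real (card ?U) * 2 powr (- (card K / 8)) \<le> (3 / 2) ^ card K" by simp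
  then show ?thesis by (simp add: powr_minus field_simps)
qed

lemma hamming_ball_entropy:
  "real M / 8 \<le> ln (2 ^ M / ((3 / 2) ^ M * 2 powr (M / 8)))"
proof -
  \<comment> \<open>Per coordinate the claim is ln 2 + 1 <= 8 ln (4/3), that is 2 e <= (4/3)^8. The
    right side is just below 10, so e <= 3 suffices.\<close>
  have "2 * exp 1 \<le> (4 / 3 :: real) ^ 8" using exp_le by (simp add: power_divide)
  then have "ln (2 * exp 1) \<le> ln ((4 / 3 :: real) ^ 8)" by (subst ln_le_cancel_iff) auto
  then have "ln 2 + 1 \<le> 8 * ln (4 / 3 :: real)" by (simp add: ln_mult ln_realpow)
  then have "real M * (ln 2 + 1) \<le> real M * (8 * ln (4 / 3 :: real))" by (intro mult_left_mono) auto
  moreover have "2 ^ M / ((3 / 2) ^ M * 2 powr (M / 8)) = (4 / 3 :: real) ^ M / 2 powr (M / 8)"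
    by (simp add: field_simps flip: power_mult_distrib)
  moreover have "ln ((4 / 3 :: real) ^ M / 2 powr (M / 8)) = M * ln (4 / 3) - M / 8 * ln 2"
    by (simp add: ln_div ln_realpow)
  ultimately show ?thesis by (simp add: field_simps)
qed

section \<open>The unit cube and norms on it\<close>

lemma unit_cube_eq_cbox: "unit_cube = cbox 0 (1 :: real^'d::finite)"
  by (auto simp: unit_cube_def mem_box_cart)

lemma unit_cube_borel [measurable]: "(unit_cube :: (real^'d::finite) set) \<in> sets borel"
  by (simp add: unit_cube_eq_cbox)

lemma emeasure_lborel_cbox_cart:
  fixes a b :: "real^'d::finite"
  assumes "\<And>i. a $ i \<le> b $ i"
  shows "emeasure lborel (cbox a b) = ennreal (\<Prod>i\<in>UNIV. b $ i - a $ i)"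
proof -
  have "cbox a b \<noteq> {}" using assms by (simp add: interval_ne_empty_cart)
  from content_cbox_cart[OF this] show ?thesis
    using emeasure_eq_ennreal_measure[of lborel "cbox a b"] emeasure_lborel_cbox_finite[of a b]
    by (simp add: less_top)
qed

lemma emeasure_unit_cube: "emeasure lborel (unit_cube :: (real^'d::finite) set) = 1"
  unfolding unit_cube_eq_cbox by (subst emeasure_lborel_cbox_cart) auto

text \<open>Instead of Jensen's inequality, the cruder \<open>t \<le> 1 + t powr p\<close> suffices.\<close>

lemma l1_norm_le_lp_norm_cube:
  fixes u :: "real^'d::finite \<Rightarrow> real"
  assumes [measurable]: "u \<in> borel_measurable borel" and p: "p \<ge> 1" and r: "r > 0"
    and less: "lp_norm_cube p u < ennreal r"
  shows "(\<integral>\<^sup>+z\<in>unit_cube. ennreal \<bar>u z\<bar> \<partial>lborel) \<le> ennreal (2 * r)"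
proof -
  define I where "I = (\<integral>\<^sup>+z\<in>unit_cube. ennreal (\<bar>u z\<bar> powr p) \<partial>lborel)"
  have fin: "I < \<infinity>" and "ennreal (enn2real I powr (1 / p)) < ennreal r"
    using less by (auto simp: lp_norm_cube_def Let_def I_def[symmetric] less_top split: if_splits)
  then have "enn2real I powr (1 / p) < r" by (simp add: ennreal_less_iff)
  then have "(enn2real I powr (1 / p)) powr p \<le> r powr p" using p by (intro powr_mono2) auto
  then have "enn2real I \<le> r powr p" using p by (simp add: powr_powr)
  then have I: "I \<le> ennreal (r powr p)"
    using fin by (metis ennreal_enn2real_if ennreal_leI infinity_ennreal_def less_irrefl)
  \<comment> \<open>The pointwise inequality is used at t = |u z| / r and multiplied by r. Then both
    summands integrate to at most r, the first because the cube has volume 1.\<close>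
  have pt: "\<bar>u z\<bar> \<le> r + r / r powr p * \<bar>u z\<bar> powr p" for z
  proof (cases "\<bar>u z\<bar> \<le> r")
    case True
    then show ?thesis using r by (simp add: add_increasing2)
  next
    case False
    then have "(\<bar>u z\<bar> / r) powr 1 \<le> (\<bar>u z\<bar> / r) powr p" using r p by (intro powr_mono) auto
    then have "\<bar>u z\<bar> \<le> r * (\<bar>u z\<bar> powr p / r powr p)"
      using r by (simp add: powr_divide field_simps)
    then show ?thesis using r by simp
  qed
  have "(\<integral>\<^sup>+z\<in>unit_cube. ennreal \<bar>u z\<bar> \<partial>lborel)
      \<le> (\<integral>\<^sup>+z. ennreal r * indicator unit_cube z
           + ennreal (r / r powr p) * (ennreal (\<bar>u z\<bar> powr p) * indicator unit_cube z) \<partial>lborel)"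
    using pt r
    by (intro nn_integral_mono)
      (auto simp: indicator_def ennreal_plus[symmetric] ennreal_mult[symmetric] simp del: ennreal_plus)
  also have "\<dots> = ennreal r + ennreal (r / r powr p) * I"
    unfolding I_def by (subst nn_integral_add) (auto simp: nn_integral_cmult emeasure_unit_cube)
  also have "\<dots> \<le> ennreal r + ennreal (r / r powr p) * ennreal (r powr p)"
    by (intro add_left_mono mult_left_mono I) auto
  also have "\<dots> = ennreal (2 * r)"
    using r by (simp flip: ennreal_mult ennreal_plus)
  finally show ?thesis .
qed

text \<open>With an integer q, cubes of side 2 h = 1 / q tile the unit cube. Since R >= 1, rounding
  up at most doubles, so h is at least a quarter of the ideal bandwidth; this is the origin of
  \<open>4 powr (- \<beta>)\<close>.\<close>

lemma bandwidth_bounds: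
  fixes \<beta> d R :: real
  assumes \<beta>: "\<beta> \<ge> 1" and d: "d \<ge> 1" and R: "R \<ge> 1"
  defines "q \<equiv> nat \<lceil>R powr (1 / (2 * \<beta> + d))\<rceil>"
  defines "h \<equiv> 1 / (2 * real q)"
  shows "q \<ge> 1" "R powr (1 / (2 * \<beta> + d)) \<le> q" "0 < h" "h \<le> 1 / 2"
    "h \<le> R powr (- (1 / (2 * \<beta> + d)))" "h powr \<beta> \<ge> 4 powr (- \<beta>) * R powr (- \<beta> / (2 * \<beta> + d))"
proof -
  let ?g = "1 / (2 * \<beta> + d)"
  have R1: "R powr ?g \<ge> 1" using R \<beta> d by (intro ge_one_powr_ge_zero) auto
  show q1: "q \<ge> 1" using R1 unfolding q_def by linarith
  show ge: "R powr ?g \<le> q" unfolding q_def by linarith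
  have le: "q \<le> 2 * R powr ?g" using R1 unfolding q_def by linarith
  show h0: "0 < h" using q1 by (simp add: h_def)
  show "h \<le> 1 / 2" using q1 by (simp add: h_def field_simps)
  have "h \<le> 1 / R powr ?g"
    unfolding h_def using ge R1 q1 by (intro divide_left_mono mult_pos_pos) auto
  then show "h \<le> R powr (- ?g)" by (simp add: powr_minus inverse_eq_divide)
  have "h \<ge> 1 / (4 * R powr ?g)"
    unfolding h_def using le q1 R1 R by (intro divide_left_mono mult_pos_pos) auto
  then have "h powr \<beta> \<ge> (1 / (4 * R powr ?g)) powr \<beta>"
    using \<beta> R1 by (intro powr_mono2) auto
  also have "(1 / (4 * R powr ?g)) powr \<beta> = 4 powr (- \<beta>) * (R powr ?g) powr (- \<beta>)"
    by (simp add: powr_divide powr_mult powr_minus inverse_eq_divide)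
  also have "\<dots> = 4 powr (- \<beta>) * R powr (- \<beta> / (2 * \<beta> + d))"
    by (simp add: powr_powr)
  finally show "h powr \<beta> \<ge> 4 powr (- \<beta>) * R powr (- \<beta> / (2 * \<beta> + d))" .
qed

text \<open>Here \<open>V\<close> stands for \<open>n_max * T_max\<^sup>2\<close>. The first assumption amounts to
  \<open>V \<le> (m * V) powr (2 * \<beta> / (2 * \<beta> + d))\<close>, which makes the divergence caused by a single
  trajectory in the support of a bump harmless.\<close>

lemma divergence_scale:
  fixes \<beta> C\<^sub>c V h :: real and d m :: nat
  assumes "real m powr (2 * \<beta> / d) \<ge> V" and \<beta>: "\<beta> \<ge> 1" and d: "d \<ge> 1" and m: "m \<ge> 1"
    and V: "V > 0" and Cc: "C\<^sub>c > 0" and \<Lambda>: "\<Lambda> \<ge> 1" and h: "h > 0"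
    and hR: "h \<le> (m * V / \<Lambda>) powr (- (1 / (2 * \<beta> + d)))"
  shows "max 1 (real m * C\<^sub>c * (real d * h) ^ d) * (V * (h powr \<beta>)\<^sup>2) \<le> max 1 (C\<^sub>c * real d ^ d) * \<Lambda>"
proof -
  let ?s = "2 * \<beta> + d"
  let ?R = "m * V / \<Lambda>"
  have s: "?s > 0" using \<beta> d by simp
  have N: "m * V > 0" and R: "?R > 0" using m V \<Lambda> by auto
  have h2: "(h powr \<beta>)\<^sup>2 = h powr (2 * \<beta>)" using h by (simp add: powr_add[symmetric] power2_eq_square)
  \<comment> \<open>This controls the second entry of the maximum, where the number of trajectories
    starting in a bump is of order m h^d.\<close>
  have "h powr ?s \<le> (?R powr (- (1 / ?s))) powr ?s" using hR h s by (intro powr_mono2) auto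
  also have "\<dots> = 1 / ?R" using s R V \<Lambda> by (simp only: powr_powr) (simp add: powr_minus inverse_eq_divide abs_mult)
  finally have hs: "m * V * h powr ?s \<le> \<Lambda>" using N \<Lambda> by (simp add: field_simps)
  have one: "V * h powr (2 * \<beta>) \<le> \<Lambda>"
  proof -
    \<comment> \<open>Raising the assumption on \<open>V\<close> to the power d and then multiplying
      by V^(2 \<beta>) brings in the product m V, in terms of which \<open>h\<close> is
      bounded.\<close>
    have "V powr d \<le> (m powr (2 * \<beta> / d)) powr d" using assms V by (intro powr_mono2) auto
    also have "\<dots> = m powr (2 * \<beta>)" using d by (simp add: powr_powr)
    finally have "V powr d * V powr (2 * \<beta>) \<le> m powr (2 * \<beta>) * V powr (2 * \<beta>)"
      by (rule mult_right_mono) simp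
    then have "V powr ?s \<le> (m * V) powr (2 * \<beta>)" using V m by (simp add: powr_mult powr_add mult_ac)
    then have "(V powr ?s) powr (1 / ?s) \<le> ((m * V) powr (2 * \<beta>)) powr (1 / ?s)"
      using s by (intro powr_mono2) auto
    then have VN: "V \<le> (m * V) powr (2 * \<beta> / ?s)" using V s by (simp add: powr_powr)
    have "h powr (2 * \<beta>) \<le> (?R powr (- (1 / ?s))) powr (2 * \<beta>)"
      using hR h \<beta> by (intro powr_mono2) auto
    also have "\<dots> = ?R powr (- (2 * \<beta> / ?s))" by (simp add: powr_powr)
    finally have "V * h powr (2 * \<beta>) \<le> (m * V) powr (2 * \<beta> / ?s) * ?R powr (- (2 * \<beta> / ?s))"
      using VN V by (intro mult_mono) auto
    also have "\<dots> = \<Lambda> powr (2 * \<beta> / ?s)"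
      using N \<Lambda> V m by (simp add: powr_minus powr_divide field_simps)
    also have "\<dots> \<le> \<Lambda> powr 1" using \<Lambda> \<beta> d s by (intro powr_mono) (auto simp: field_simps)
    finally show ?thesis using \<Lambda> by simp
  qed
  have "m * C\<^sub>c * (d * h) ^ d * (V * h powr (2 * \<beta>)) = C\<^sub>c * d ^ d * (m * V * h powr ?s)"
    using h by (simp add: power_mult_distrib powr_add powr_realpow mult_ac)
  also have "\<dots> \<le> C\<^sub>c * d ^ d * \<Lambda>" using hs Cc by (intro mult_left_mono) auto
  finally have two: "m * C\<^sub>c * (d * h) ^ d * (V * h powr (2 * \<beta>)) \<le> C\<^sub>c * d ^ d * \<Lambda>" .
  have "max 1 (m * C\<^sub>c * (d * h) ^ d) * (V * h powr (2 * \<beta>))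
      = max (V * h powr (2 * \<beta>)) (m * C\<^sub>c * (d * h) ^ d * (V * h powr (2 * \<beta>)))"
    using V by (simp add: max_mult_distrib_right)
  also have "\<dots> \<le> max \<Lambda> (C\<^sub>c * d ^ d * \<Lambda>)" by (rule max.mono[OF one two])
  also have "\<dots> = max 1 (C\<^sub>c * d ^ d) * \<Lambda>" using \<Lambda> by (simp add: max_mult_distrib_right)
  finally show ?thesis by (simp add: h2)
qed

text \<open>The centres of the \<open>q ^ d\<close> subcubes of the unit cube with side length \<open>1 / q\<close>.\<close>

definition grid :: "nat \<Rightarrow> ('d::finite \<Rightarrow> nat) set" where
  "grid q = (\<Pi>\<^sub>E i\<in>UNIV. {..<q})"

definition grid_point :: "nat \<Rightarrow> ('d::finite \<Rightarrow> nat) \<Rightarrow> real^'d" where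
  "grid_point q \<kappa> = (\<chi> i. (2 * real (\<kappa> i) + 1) / (2 * real q))"

lemma finite_grid: "finite (grid q)" and card_grid: "card (grid q :: ('d::finite \<Rightarrow> nat) set) = q ^ CARD('d)"
  by (auto simp: grid_def card_PiE intro!: finite_PiE)

lemma grid_point_bounds:
  assumes "\<kappa> \<in> grid q"
  shows "1 / (2 * real q) \<le> grid_point q \<kappa> $ i" "grid_point q \<kappa> $ i \<le> 1 - 1 / (2 * real q)"
proof -
  have k: "Suc (\<kappa> i) \<le> q" using assms by (auto simp: grid_def PiE_iff Suc_le_eq)
  then have le: "real (\<kappa> i) + 1 \<le> real q" by linarith
  show "1 / (2 * real q) \<le> grid_point q \<kappa> $ i"
    unfolding grid_point_def by (simp add: divide_right_mono)
  have "grid_point q \<kappa> $ i \<le> (2 * real q - 1) / (2 * real q)"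
    unfolding grid_point_def using le by (simp add: divide_right_mono)
  also have "\<dots> = 1 - 1 / (2 * real q)" using k by (simp add: field_simps)
  finally show "grid_point q \<kappa> $ i \<le> 1 - 1 / (2 * real q)" .
qed

lemma grid_point_in_unit_cube: "\<kappa> \<in> grid q \<Longrightarrow> grid_point q \<kappa> \<in> unit_cube"
  using grid_point_bounds[of \<kappa> q] unfolding unit_cube_def
  by (auto intro: order.trans[of _ "1 / (2 * real q)"] order.trans[of _ "1 - 1 / (2 * real q)"])

lemma separated_grid:
  assumes "h = 1 / (2 * real q)"
  shows "separated h (grid q) (grid_point q)"
  unfolding separated_def
proof (intro ballI impI)
  fix \<kappa> \<kappa>' :: "'a \<Rightarrow> nat" assume "\<kappa> \<in> grid q" "\<kappa>' \<in> grid q" "\<kappa> \<noteq> \<kappa>'"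
  then obtain i where i: "\<kappa> i \<noteq> \<kappa>' i" and q: "q > 0" by (auto simp: grid_def PiE_iff fun_eq_iff)
  have "grid_point q \<kappa> $ i - grid_point q \<kappa>' $ i = (real (\<kappa> i) - real (\<kappa>' i)) / real q"
    using q by (simp add: grid_point_def field_simps)
  moreover have "\<bar>real (\<kappa> i) - real (\<kappa>' i)\<bar> \<ge> 1" using i by linarith
  ultimately have "\<bar>grid_point q \<kappa> $ i - grid_point q \<kappa>' $ i\<bar> \<ge> 2 * h"
    using q assms by (simp add: divide_right_mono)
  then show "\<exists>i. \<bar>grid_point q \<kappa> $ i - grid_point q \<kappa>' $ i\<bar> \<ge> 2 * h" by blast
qed

section \<open>The lower bounds\<close>

context bump_profile
begin

lemma bump_field_borel_measurable:
  assumes "h > 0" "finite K" "separated h K z" "\<And>\<kappa>. \<kappa> \<in> K \<Longrightarrow> 0 \<le> \<theta> \<kappa> \<and> \<theta> \<kappa> \<le> 1" "A \<ge> 0"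
  shows "bump_field A h K z i\<^sub>0 \<theta> \<in> borel_measurable borel"
proof (rule bump_field_lipschitz[OF assms, where i\<^sub>0 = i\<^sub>0])
  fix \<Lambda> :: real
  assume "\<Lambda> > 0"
    "\<And>x y. norm (bump_field A h K z i\<^sub>0 \<theta> x - bump_field A h K z i\<^sub>0 \<theta> y) \<le> \<Lambda> * norm (x - y)"
  then have "\<Lambda>-lipschitz_on UNIV (bump_field A h K z i\<^sub>0 \<theta>)"
    by (auto intro!: lipschitz_onI simp: dist_norm)
  then show ?thesis by (intro borel_measurable_continuous_onI lipschitz_on_continuous_on)
qed

text \<open>At an index where the two sets differ, exactly one field carries the bump, and on the
  concentric cube of side h it is at least A c^d. These cubes are disjoint, have volume h^d, and lie
  in the unit cube because the centres keep distance h from its boundary.\<close>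

lemma bump_field_l1_separation:
  fixes z :: "'k \<Rightarrow> real^'d::finite"
  assumes h: "h > 0" and K: "finite K" "separated h K z" and A: "A \<ge> 0"
    and z: "\<And>\<kappa> i. \<kappa> \<in> K \<Longrightarrow> h \<le> z \<kappa> $ i \<and> z \<kappa> $ i \<le> 1 - h"
    and S: "S \<subseteq> K" "S' \<subseteq> K"
  shows "ennreal (real (card (sym_diff S S')) * (A * c ^ CARD('d) * h ^ CARD('d)))
    \<le> (\<integral>\<^sup>+x\<in>unit_cube. ennreal (norm (bump_field A h K z i\<^sub>0 (indicator S) x
          - bump_field A h K z i\<^sub>0 (indicator S') x)) \<partial>lborel)"
proof -
  let ?D = "sym_diff S S'"
  define Q where "Q \<kappa> = cbox (\<chi> i. z \<kappa> $ i - h / 2) (\<chi> i. z \<kappa> $ i + h / 2)" for \<kappa>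
  have Q: "x \<in> Q \<kappa> \<longleftrightarrow> (\<forall>i. \<bar>x $ i - z \<kappa> $ i\<bar> \<le> h / 2)" for x \<kappa>
    unfolding Q_def mem_box_cart abs_le_iff vec_lambda_beta by (intro iff_allI) auto
  have vol: "emeasure lborel (Q \<kappa>) = ennreal (h ^ CARD('d))" for \<kappa>
    unfolding Q_def using h by (subst emeasure_lborel_cbox_cart) auto
  have ind01: "0 \<le> indicat_real U \<kappa> \<and> indicat_real U \<kappa> \<le> 1" for U :: "'k set" and \<kappa>
    by (auto simp: indicator_def)
  have D: "finite ?D" "?D \<subseteq> K" using S K by (auto intro: finite_subset)
  have pt: "(\<Sum>\<kappa>\<in>?D. ennreal (A * c ^ CARD('d)) * indicator (Q \<kappa>) x)
      \<le> ennreal (norm (bump_field A h K z i\<^sub>0 (indicator S) x - bump_field A h K z i\<^sub>0 (indicator S') x))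
        * indicator unit_cube x" for x
  proof (cases "\<exists>\<kappa>\<in>?D. x \<in> Q \<kappa>")
    case False
    then show ?thesis by (subst sum.neutral) auto
  next
    case True
    then obtain \<kappa> where \<kappa>: "\<kappa> \<in> ?D" "x \<in> Q \<kappa>" by blast
    have \<kappa>K: "\<kappa> \<in> K" using \<kappa> D by blast
    have near: "\<bar>x $ i - z \<kappa> $ i\<bar> \<le> h / 2" for i using \<kappa> by (simp add: Q)
    have near': "\<bar>x $ i - z \<kappa> $ i\<bar> < h" for i using near[of i] h by linarith
    have "x \<notin> Q \<kappa>'" if "\<kappa>' \<in> ?D - {\<kappa>}" for \<kappa>'
    proof
      assume "x \<in> Q \<kappa>'"
      have "\<kappa>' \<in> K" "\<kappa> \<noteq> \<kappa>'" using that D by auto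
      then obtain i where "\<bar>z \<kappa> $ i - z \<kappa>' $ i\<bar> \<ge> 2 * h"
        using K(2) \<kappa>K unfolding separated_def by blast
      moreover have "\<bar>x $ i - z \<kappa>' $ i\<bar> \<le> h / 2" using \<open>x \<in> Q \<kappa>'\<close> by (simp add: Q)
      ultimately show False using near[of i] h by linarith
    qed
    then have "(\<Sum>\<kappa>\<in>?D. ennreal (A * c ^ CARD('d)) * indicator (Q \<kappa>) x) = ennreal (A * c ^ CARD('d))"
      using \<kappa> by (subst sum.remove[OF D(1) \<kappa>(1)]) (simp add: sum.neutral)
    also have "\<dots> \<le> ennreal (A * bump h (z \<kappa>) (\<lambda>_. 0) x)"
      using A near h by (intro ennreal_leI mult_left_mono bump_lower) auto
    also have "A * bump h (z \<kappa>) (\<lambda>_. 0) x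
        = norm (bump_field A h K z i\<^sub>0 (indicator S) x - bump_field A h K z i\<^sub>0 (indicator S') x)"
    proof -
      have "axis i\<^sub>0 a - axis i\<^sub>0 b = (axis i\<^sub>0 (a - b) :: real^'d)" for a b :: real
        by (simp add: axis_def vec_eq_iff)
      then show ?thesis
        using \<kappa>(1) A bump_0(1)[of h "z \<kappa>" x]
        by (auto simp: bump_field_eq[OF h K ind01 \<kappa>K near'] norm_axis indicator_def abs_mult)
    qed
    also have "x \<in> unit_cube"
      unfolding unit_cube_def
    proof (intro CollectI allI)
      fix i show "0 \<le> x $ i \<and> x $ i \<le> 1" using near[of i] z[OF \<kappa>K, of i] h by (intro conjI) linarith+
    qed
    ultimately show ?thesis by simp
  qed
  have "ennreal (real (card ?D) * (A * c ^ CARD('d) * h ^ CARD('d)))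
      = (\<Sum>\<kappa>\<in>?D. ennreal (A * c ^ CARD('d)) * emeasure lborel (Q \<kappa>))"
    using A h c_pos by (simp add: vol ennreal_mult ennreal_of_nat_eq_real_of_nat mult_ac)
  also have "\<dots> = (\<integral>\<^sup>+x. (\<Sum>\<kappa>\<in>?D. ennreal (A * c ^ CARD('d)) * indicator (Q \<kappa>) x) \<partial>lborel)"
    by (subst nn_integral_sum) (auto simp: Q_def nn_integral_cmult intro!: sum.cong)
  also have "\<dots> \<le> (\<integral>\<^sup>+x\<in>unit_cube. ennreal (norm (bump_field A h K z i\<^sub>0 (indicator S) x
          - bump_field A h K z i\<^sub>0 (indicator S') x)) \<partial>lborel)"
    by (intro nn_integral_mono pt)
  finally show ?thesis .
qed

end

text \<open>One design together with an amplitude \<open>a\<close> that is already small enough.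
  \<open>a_small\<close> caps the divergence at 1 / (32 (2 \<beta> + d)) per active bump and unit of
  \<Lambda>. The factor 2 \<beta> + d is there because, at the bandwidth for the sup loss, the
  log-cardinality of the grid is bounded below only by a multiple of ln N / (2 \<beta> + d).\<close>

locale bump_experiment = bump_profile \<psi> n B c for \<psi> n B c +
  fixes \<beta> a L\<^sub>\<beta> C\<^sub>n C\<^sub>c :: real and L :: "nat \<Rightarrow> real"
    and m :: nat and n\<^sub>o :: "nat \<Rightarrow> nat" and T :: "nat \<Rightarrow> real" and t :: "nat \<Rightarrow> nat \<Rightarrow> real"
    and x :: "nat \<Rightarrow> real^'d::finite" and P :: "(real^'d) measure"
    and d V N :: real and F :: "(real^'d \<Rightarrow> real^'d) set"
  assumes d_def: "d = real CARD('d)" and F_def: "F = smooth_class \<beta> L L\<^sub>\<beta>"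
    and V_def: "V = real (Max (n\<^sub>o ` {1..m})) * (Max (T ` {1..m}))\<^sup>2" and N_def: "N = real m * V"
    and \<beta>: "\<beta> \<ge> 1" and n: "n = smoothness_order \<beta>"
    and a: "a > 0" and Cn: "C\<^sub>n > 0" and Cc: "C\<^sub>c > 0"
    and L: "\<And>k. k \<le> smoothness_order \<beta> \<Longrightarrow> real CARD('d) ^ k * (a * B ^ CARD('d)) \<le> L k"
    and L\<beta>: "2 * real CARD('d) ^ Suc (smoothness_order \<beta>) * (a * B ^ CARD('d)) \<le> L\<^sub>\<beta>"
    and a_small: "C\<^sub>n * a\<^sup>2 * max 1 (C\<^sub>c * real CARD('d) ^ CARD('d)) \<le> 1 / (32 * (2 * \<beta> + real CARD('d)))"
    and design: "observation_design m n\<^sub>o T t" and noise: "noise_condition C\<^sub>n P"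
    and centered: "centered_distribution P" and cover: "cover_condition C\<^sub>c m x"
begin

lemma d_ge_1: "d \<ge> 1" by (simp add: d_def)

lemma m_ge_1: "m \<ge> 1" using design by (simp add: observation_design_def)

lemma V_pos: "V > 0"
proof -
  have 1: "1 \<in> {1..m}" using m_ge_1 by simp
  have "0 < T 1" "1 \<le> n\<^sub>o 1" using design 1 by (auto simp: observation_design_def)
  moreover have "T 1 \<le> Max (T ` {1..m})" "n\<^sub>o 1 \<le> Max (n\<^sub>o ` {1..m})" using 1 by (auto intro!: Max_ge)
  ultimately have "0 < Max (T ` {1..m})" "0 < Max (n\<^sub>o ` {1..m})" by linarith+
  then show ?thesis unfolding V_def by simp
qed

text \<open>Reduces every lower bound to counting. \<open>M\<close> caps the number of active bumps
  of a hypothesis and \<open>\<Lambda>\<close> is the factor by which \<open>N\<close> is deflated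
  in the bandwidth. Together they bound the divergence by M \<Lambda> / (32 (2 \<beta> + d)), which
  \<open>ent\<close> weighs against the entropy.\<close>

lemma minimax_prob_bump_fields:
  fixes z :: "'k \<Rightarrow> real^'d" and \<theta> :: "'j \<Rightarrow> 'k \<Rightarrow> real" and E :: "(real^'d \<Rightarrow> real^'d) \<Rightarrow> (real^'d \<Rightarrow> real^'d) \<Rightarrow> bool"
  assumes mV: "real m powr (2 * \<beta> / d) \<ge> V" and \<Lambda>: "\<Lambda> \<ge> 1"
    and h: "h > 0" "h \<le> 1" "h \<le> (N / \<Lambda>) powr (- (1 / (2 * \<beta> + d)))"
    and K: "finite K" "separated h K z" "\<And>\<kappa>. \<kappa> \<in> K \<Longrightarrow> z \<kappa> \<in> unit_cube"
    and J: "finite J" "J \<noteq> {}" and \<theta>: "\<And>j \<kappa>. j \<in> J \<Longrightarrow> \<kappa> \<in> K \<Longrightarrow> 0 \<le> \<theta> j \<kappa> \<and> \<theta> j \<kappa> \<le> 1"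
    and M: "\<And>j. j \<in> J \<Longrightarrow> real (card {\<kappa>\<in>K. \<theta> j \<kappa> \<noteq> 0}) \<le> M"
    and count: "\<And>g. g \<in> borel_measurable borel \<Longrightarrow>
       real (card {j\<in>J. \<not> E g (bump_field (a * h powr \<beta>) h K z i\<^sub>0 (\<theta> j))}) \<le> b"
    and b: "b > 0" and ent: "M * \<Lambda> / (32 * (2 * \<beta> + d)) + 1 \<le> 3 / 4 * ln (card J / b)"
  shows "minimax_prob m n\<^sub>o t x P F E \<ge> 1 / 4"
proof (rule minimax_prob_ge_quarter[where ref = "\<lambda>_. 0" and E = E
      and f = "\<lambda>j. bump_field (a * h powr \<beta>) h K z i\<^sub>0 (\<theta> j)" and K = J and b = b
      and \<kappa> = "M * \<Lambda> / (32 * (2 * \<beta> + d))" and c = C\<^sub>n])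
  let ?A = "a * h powr \<beta>"
  have A: "?A \<ge> 0" using a by simp
  show "noise_condition C\<^sub>n P" "finite J" "J \<noteq> {}" "b > 0" "M * \<Lambda> / (32 * (2 * \<beta> + d)) + 1 \<le> 3 / 4 * ln (card J / b)"
    by (rule noise J b ent)+
  show "real (card {j\<in>J. \<not> E g (bump_field ?A h K z i\<^sub>0 (\<theta> j))}) \<le> b" if "g \<in> borel_measurable borel" for g
    by (rule count) fact
  show "prob_space P" "sets P = sets borel" using centered by (auto simp: centered_distribution_def)
  show "bump_field ?A h K z i\<^sub>0 (\<theta> j) \<in> F" if "j \<in> J" for j
    unfolding F_def
    by (rule bump_field_smooth[OF h(1) K(1,2) \<theta>[OF that] \<beta> n h(2) _ L L\<beta>]) (use a in auto)
  obtain j0 where "j0 \<in> J" using J by blast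
  from M[OF this] have M0: "M \<ge> 0" using of_nat_0_le_iff order.trans by blast
  then show "M * \<Lambda> / (32 * (2 * \<beta> + d)) \<ge> 0" using \<Lambda> \<beta> d_ge_1 by simp
  fix j assume j: "j \<in> J"
  let ?R = "max 1 (real m * C\<^sub>c * (real CARD('d) * h) ^ CARD('d))"
  have "(\<Sum>(k, i)\<in>obs_index m n\<^sub>o. C\<^sub>n * (norm (flow (bump_field ?A h K z i\<^sub>0 (\<theta> j)) (x k) (t k i)
            - flow (\<lambda>_. 0) (x k) (t k i)))\<^sup>2)
      \<le> real (card {\<kappa>\<in>K. \<theta> j \<kappa> \<noteq> 0}) * ?R
        * (C\<^sub>n * real (Max (n\<^sub>o ` {1..m})) * (Max (T ` {1..m}))\<^sup>2 * ?A\<^sup>2)"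
    by (rule bump_field_divergence[OF h(1) K(1,2) \<theta>[OF j] design cover A _ K(3)]) (use Cn in auto)
  also have "\<dots> = real (card {\<kappa>\<in>K. \<theta> j \<kappa> \<noteq> 0}) * (C\<^sub>n * a\<^sup>2 * (?R * (V * (h powr \<beta>)\<^sup>2)))"
    by (simp add: V_def power_mult_distrib mult_ac)
  also have "\<dots> \<le> M * (C\<^sub>n * a\<^sup>2 * (max 1 (C\<^sub>c * real CARD('d) ^ CARD('d)) * \<Lambda>))"
  proof (rule mult_mono[OF M[OF j] mult_left_mono])
    show "?R * (V * (h powr \<beta>)\<^sup>2) \<le> max 1 (C\<^sub>c * real CARD('d) ^ CARD('d)) * \<Lambda>"
      by (rule divergence_scale[OF mV[unfolded d_def] \<beta> _ m_ge_1 V_pos Cc \<Lambda> h(1) h(3)[unfolded N_def d_def]]) simp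
  qed (use Cn M0 V_pos in \<open>auto intro!: mult_nonneg_nonneg simp: max.coboundedI1\<close>)
  also have "\<dots> = M * \<Lambda> * (C\<^sub>n * a\<^sup>2 * max 1 (C\<^sub>c * real CARD('d) ^ CARD('d)))" by (simp add: mult_ac)
  also have "\<dots> \<le> M * \<Lambda> * (1 / (32 * (2 * \<beta> + d)))"
    using M0 \<Lambda> a_small by (intro mult_left_mono) (auto simp: d_def)
  finally show "(\<Sum>(k, i)\<in>obs_index m n\<^sub>o. C\<^sub>n * (norm (flow (bump_field ?A h K z i\<^sub>0 (\<theta> j)) (x k) (t k i)
            - flow (\<lambda>_. 0) (x k) (t k i)))\<^sup>2) \<le> M * \<Lambda> / (32 * (2 * \<beta> + d))" by simp
qed

text \<open>Neighbouring heights differ by A / 64. Two hypotheses whose errors both stay below the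
  rate would give C A / 64 < 2 rate, which the factor 128 = 2 * 64 excludes. So at most one height
  is compatible with a given estimate.\<close>

lemma pointwise_lower_bound:
  assumes mV: "real m powr (2 * \<beta> / d) \<ge> V" and N: "N \<ge> 1" and x0: "x\<^sub>0 \<in> unit_cube"
    and C: "128 * 4 powr \<beta> \<le> C * a"
  shows "minimax_prob m n\<^sub>o t x P F
    (\<lambda>g f. C * norm (g x\<^sub>0 - f x\<^sub>0) \<ge> N powr (- \<beta> / (2 * \<beta> + d))) \<ge> 1 / 4"
proof -
  define h where "h = 1 / (2 * real (nat \<lceil>N powr (1 / (2 * \<beta> + d))\<rceil>))"
  note hb = bandwidth_bounds[OF \<beta> d_ge_1 N, folded h_def]
  let ?rate = "N powr (- \<beta> / (2 * \<beta> + d))"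
  let ?A = "a * h powr \<beta>"
  fix i\<^sub>0 :: 'd
  let ?f = "\<lambda>k::nat. bump_field ?A h {()} (\<lambda>_. x\<^sub>0) i\<^sub>0 (\<lambda>_. real k / 64)"
  have C0: "C > 0" using C a by (smt (verit) powr_gt_zero zero_less_mult_iff mult_nonpos_nonneg)
  have "128 * ?rate = (128 * 4 powr \<beta>) * (4 powr (- \<beta>) * ?rate)" by (simp add: powr_minus)
  also have "\<dots> \<le> (C * a) * h powr \<beta>" by (intro mult_mono C hb) (use C0 a in auto)
  finally have rate: "128 * ?rate \<le> C * ?A" by simp
  show ?thesis
  proof (rule minimax_prob_bump_fields[where \<Lambda> = 1 and h = h and K = "{()}" and z = "\<lambda>_. x\<^sub>0"
        and J = "{..<64::nat}" and \<theta> = "\<lambda>k _. real k / 64" and M = 1 and b = 1 and i\<^sub>0 = i\<^sub>0, OF mV])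
    fix g :: "real^'d \<Rightarrow> real^'d"
    let ?S = "{k \<in> {..<64::nat}. \<not> ?rate \<le> C * norm (g x\<^sub>0 - ?f k x\<^sub>0)}"
    have val: "?f k x\<^sub>0 = axis i\<^sub>0 (?A * (real k / 64))" if "k \<in> {..<64}" for k
      using that hb(3) by (simp add: bump_field_def bump_0(3))
    have "k = k'" if k: "k \<in> ?S" "k' \<in> ?S" for k k'
    proof (rule ccontr)
      assume "k \<noteq> k'"
      then have "1 \<le> \<bar>real k - real k'\<bar>" by linarith
      then have "C * ?A * 1 \<le> C * ?A * \<bar>real k - real k'\<bar>" using C0 a by (intro mult_left_mono) auto
      also have "\<dots> = 64 * (C * norm (?f k x\<^sub>0 - ?f k' x\<^sub>0))"
      proof -
        have "?f k x\<^sub>0 - ?f k' x\<^sub>0 = axis i\<^sub>0 (?A * ((real k - real k') / 64))"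
          using k by (subst (1 2) val) (auto simp: axis_def vec_eq_iff field_simps)
        then show ?thesis using a by (simp add: norm_axis abs_mult)
      qed
      also have "norm (?f k x\<^sub>0 - ?f k' x\<^sub>0) \<le> norm (g x\<^sub>0 - ?f k x\<^sub>0) + norm (g x\<^sub>0 - ?f k' x\<^sub>0)"
        by (metis dist_norm dist_triangle3)
      finally have "C * ?A \<le> 64 * (C * norm (g x\<^sub>0 - ?f k x\<^sub>0)) + 64 * (C * norm (g x\<^sub>0 - ?f k' x\<^sub>0))"
        using C0 by (simp add: distrib_left)
      moreover have "C * norm (g x\<^sub>0 - ?f k x\<^sub>0) < ?rate" "C * norm (g x\<^sub>0 - ?f k' x\<^sub>0) < ?rate"
        using k by auto
      ultimately show False using rate by linarith
    qed
    then have "card ?S \<le> Suc 0" by (subst card_le_Suc0_iff_eq) auto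
    then show "real (card ?S) \<le> 1" by simp
  next
    \<comment> \<open>The target is 3/4 ln 64 >= 1 + 1/32; the crude ln 64 >= 2 already gives
      3/2.\<close>
    have "exp 2 \<le> (64::real)"
      using power_mono[OF exp_le, of 2] by (simp add: exp_of_nat_mult[of 2 1, simplified])
    then have "ln (exp 2) \<le> ln (64::real)" by (subst ln_le_cancel_iff) auto
    moreover have "1 / (32 * (2 * \<beta> + d)) \<le> 1 / 32" using \<beta> d_ge_1 by (simp add: field_simps)
    ultimately show "1 * 1 / (32 * (2 * \<beta> + d)) + 1 \<le> 3 / 4 * ln (real (card {..<64::nat}) / 1)" by simp
  qed (use hb x0 in \<open>auto simp: separated_def lessThan_empty_iff\<close>)
qed

text \<open>Choosing \<Lambda> = ln N, the divergence may be of order ln N because the logarithm of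
  the number of grid points is at least ln N / (2 (2 \<beta> + d)). At the centre of one bump all
  the other fields vanish, so an estimate with sup error below half the height identifies the
  bump.\<close>

lemma uniform_lower_bound:
  assumes mV: "real m powr (2 * \<beta> / d) \<ge> V" and N: "ln N \<ge> 4 * (2 * \<beta> + d)" "N > 0"
    and C: "128 * 4 powr \<beta> \<le> C * a"
  shows "minimax_prob m n\<^sub>o t x P F
    (\<lambda>g f. ennreal C * sup_loss g f \<ge> ennreal ((N / ln N) powr (- \<beta> / (2 * \<beta> + d)))) \<ge> 1 / 4"
proof -
  let ?R = "N / ln N" and ?s = "2 * \<beta> + d"
  have s: "?s \<ge> 1" using \<beta> d_ge_1 by linarith
  have l1: "ln N \<ge> 4" using N mult_left_mono[OF s, of 4] by linarith
  have R1: "?R \<ge> 1" using ln_le_minus_one[OF N(2)] l1 by (simp add: field_simps)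
  define q where "q = nat \<lceil>?R powr (1 / ?s)\<rceil>"
  define h where "h = 1 / (2 * real q)"
  note hb = bandwidth_bounds[OF \<beta> d_ge_1 R1, folded q_def, folded h_def]
  let ?rate = "?R powr (- \<beta> / ?s)"
  let ?A = "a * h powr \<beta>"
  fix i\<^sub>0 :: 'd
  let ?K = "grid q :: ('d \<Rightarrow> nat) set"
  let ?f = "\<lambda>\<kappa>. bump_field ?A h ?K (grid_point q) i\<^sub>0 (indicator {\<kappa>})"
  have C0: "C > 0" using C a by (smt (verit) powr_gt_zero zero_less_mult_iff mult_nonpos_nonneg)
  have "128 * ?rate = (128 * 4 powr \<beta>) * (4 powr (- \<beta>) * ?rate)" by (simp add: powr_minus)
  also have "\<dots> \<le> (C * a) * h powr \<beta>" by (intro mult_mono C hb) (use C0 a in auto)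
  finally have rate: "128 * ?rate \<le> C * ?A" by simp
  have rate0: "?rate > 0" using R1 by auto
  have sep: "separated h ?K (grid_point q)" by (rule separated_grid) (rule h_def)
  have ind01: "0 \<le> indicat_real U \<kappa> \<and> indicat_real U \<kappa> \<le> 1" for U :: "('d \<Rightarrow> nat) set" and \<kappa>
    by (auto simp: indicator_def)
  show ?thesis
  proof (rule minimax_prob_bump_fields[where \<Lambda> = "ln N" and h = h and K = ?K and z = "grid_point q"
        and J = ?K and \<theta> = "\<lambda>\<kappa>. indicator {\<kappa>}" and M = 1 and b = 1 and i\<^sub>0 = i\<^sub>0, OF mV])
    fix g :: "real^'d \<Rightarrow> real^'d"
    let ?S = "{\<kappa> \<in> ?K. \<not> ennreal ?rate \<le> ennreal C * sup_loss g (?f \<kappa>)}"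
    have small: "C * norm (g z - ?f \<kappa> z) < ?rate" if "\<kappa> \<in> ?S" "z \<in> unit_cube" for \<kappa> z
    proof -
      have "ennreal C * ennreal (norm (g z - ?f \<kappa> z)) \<le> ennreal C * sup_loss g (?f \<kappa>)"
        unfolding sup_loss_def using that by (intro mult_left_mono SUP_upper) auto
      also have "\<dots> < ennreal ?rate" using that by auto
      finally show ?thesis using C0 rate0 by (simp flip: ennreal_mult add: ennreal_less_iff)
    qed
    have "\<kappa> = \<kappa>'" if k: "\<kappa> \<in> ?S" "\<kappa>' \<in> ?S" for \<kappa> \<kappa>'
    proof (rule ccontr)
      assume ne: "\<kappa> \<noteq> \<kappa>'"
      let ?z = "grid_point q \<kappa> :: real^'d"
      have kK: "\<kappa> \<in> ?K" using k by simp
      have z: "?z \<in> unit_cube" by (rule grid_point_in_unit_cube[OF kK])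
      have eq: "?f \<eta> ?z = axis i\<^sub>0 (?A * (indicator {\<eta>} \<kappa> * bump h ?z (\<lambda>_. 0) ?z))" for \<eta>
        by (rule bump_field_eq[OF hb(3) finite_grid sep ind01 kK]) (simp add: hb(3))
      have "?f \<kappa> ?z - ?f \<kappa>' ?z = axis i\<^sub>0 ?A"
        unfolding eq using ne by (simp add: bump_0(3) axis_def vec_eq_iff)
      then have "C * ?A = C * norm (?f \<kappa> ?z - ?f \<kappa>' ?z)" using a by (simp add: norm_axis)
      also have "\<dots> \<le> C * (norm (g ?z - ?f \<kappa> ?z) + norm (g ?z - ?f \<kappa>' ?z))"
        using C0 by (intro mult_left_mono) (metis dist_norm dist_triangle3, simp)
      finally have "C * ?A \<le> C * norm (g ?z - ?f \<kappa> ?z) + C * norm (g ?z - ?f \<kappa>' ?z)"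
        by (simp only: distrib_left)
      with small[OF k(1) z] small[OF k(2) z] rate rate0 show False by linarith
    qed
    then have "card ?S \<le> Suc 0" by (subst card_le_Suc0_iff_eq) (auto simp: finite_grid)
    then show "real (card ?S) \<le> 1" by simp
  next
    show "real (card {\<kappa>' \<in> ?K. indicat_real {\<kappa>} \<kappa>' \<noteq> 0}) \<le> 1" for \<kappa>
    proof -
      have "card {\<kappa>' \<in> ?K. indicat_real {\<kappa>} \<kappa>' \<noteq> 0} \<le> card {\<kappa>}"
        by (intro card_mono) (auto simp: indicator_def split: if_splits)
      then show ?thesis by simp
    qed
    \<comment> \<open>Dividing \<open>N\<close> by \<open>ln N\<close> costs at most half of the
      logarithm.\<close>
    have lnln: "ln (ln N) \<le> ln N / 2"
    proof -
      have "ln (ln N / 2) \<le> ln N / 2 - 1" using l1 by (intro ln_le_minus_one) auto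
      moreover have "ln (ln N / 2) = ln (ln N) - ln 2" using l1 by (simp add: ln_div)
      moreover have "ln 2 \<le> (1::real)" using ln_le_minus_one[of 2] by simp
      ultimately show ?thesis by linarith
    qed
    have "ln N / 2 \<le> ln ?R" using lnln l1 N by (simp add: ln_div)
    then have "ln N / 2 * (1 / ?s) \<le> ln ?R * (1 / ?s)" using s by (intro mult_right_mono) auto
    \<comment> \<open>In terms of \<open>w\<close> the entropy condition is w / 32 + 1 <= 3 w / 8,
      which holds from w = 4 on; this is where ln N >= 4 (2 \<beta> + d) is used.\<close>
    moreover define w where "w = ln N / ?s"
    ultimately have "w / 2 \<le> ln ?R * (1 / ?s)" by (simp add: w_def algebra_simps)
    also have "\<dots> = ln (?R powr (1 / ?s))" using R1 by (simp add: ln_powr)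
    also have "\<dots> \<le> ln (real q)" using hb(1,2) R1 by (subst ln_le_cancel_iff) auto
    also have "\<dots> \<le> real CARD('d) * ln (real q)"
      using mult_right_mono[of 1 "real CARD('d)" "ln (real q)"] hb(1) by simp
    also have "\<dots> = ln (real (card ?K) / 1)" using hb(1) by (simp add: card_grid ln_realpow)
    finally have "w / 2 \<le> ln (real (card ?K) / 1)" .
    moreover have "4 \<le> w" using N s by (simp add: w_def field_simps)
    moreover have "1 * ln N / (32 * ?s) = w / 32" by (simp add: w_def)
    ultimately show "1 * ln N / (32 * ?s) + 1 \<le> 3 / 4 * ln (real (card ?K) / 1)" by linarith
    have "0 < card ?K" using hb(1) by (simp add: card_grid)
    then show "?K \<noteq> {}" by force
    show "h \<le> 1" using hb(4) by linarith
  qed (use hb l1 sep in \<open>auto simp: finite_grid grid_point_in_unit_cube indicator_def\<close>)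
qed

text \<open>Two subsets compatible with one estimate have fields at L^1 distance at most 4 rate / C,
  each L^1 error being at most twice rate / C. Compared with the separation per differing index, and
  with M (2 h)^d = 1, this confines their Hamming distance to M / 8; hence the constant 32 * 2^d = 4
  * 8 * 2^d.\<close>

lemma lp_lower_bound:
  assumes mV: "real m powr (2 * \<beta> / d) \<ge> V" and N: "ln N \<ge> 4 * (2 * \<beta> + d)" "N > 0"
    and p: "p \<ge> 1" and C: "32 * 2 ^ CARD('d) * 4 powr \<beta> \<le> C * a * c ^ CARD('d)"
  shows "minimax_prob m n\<^sub>o t x P F
    (\<lambda>g f. ennreal C * lp_norm_cube p (\<lambda>z. norm (g z - f z)) \<ge> ennreal (N powr (- \<beta> / (2 * \<beta> + d)))) \<ge> 1 / 4"
proof -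
  let ?s = "2 * \<beta> + d"
  have s: "?s \<ge> 1" using \<beta> d_ge_1 by linarith
  have l1: "ln N \<ge> 4" using N mult_left_mono[OF s, of 4] by linarith
  have N1: "N \<ge> 1" using ln_le_minus_one[OF N(2)] l1 by linarith
  define q where "q = nat \<lceil>N powr (1 / ?s)\<rceil>"
  define h where "h = 1 / (2 * real q)"
  note hb = bandwidth_bounds[OF \<beta> d_ge_1 N1, folded q_def, folded h_def]
  let ?rate = "N powr (- \<beta> / ?s)"
  let ?A = "a * h powr \<beta>"
  fix i\<^sub>0 :: 'd
  let ?K = "grid q :: ('d \<Rightarrow> nat) set"
  let ?M = "card ?K"
  let ?f = "\<lambda>S. bump_field ?A h ?K (grid_point q) i\<^sub>0 (indicator S)"
  let ?b = "(3 / 2) ^ ?M * 2 powr (real ?M / 8)"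
  have c0: "c ^ CARD('d) > 0" using c_pos by simp
  have "0 < C * a * c ^ CARD('d)" by (rule less_le_trans[OF _ C]) simp
  then have "0 < C * (a * c ^ CARD('d))" by (simp only: mult.assoc)
  then have C0: "C > 0" using zero_less_mult_pos2[of C "a * c ^ CARD('d)"] a c0 by simp
  have "32 * 2 ^ CARD('d) * ?rate = (32 * 2 ^ CARD('d) * 4 powr \<beta>) * (4 powr (- \<beta>) * ?rate)" by (simp add: powr_minus)
  also have "\<dots> \<le> (C * a * c ^ CARD('d)) * h powr \<beta>" by (intro mult_mono C hb) (use C0 a c0 in auto)
  finally have rate: "32 * 2 ^ CARD('d) * ?rate \<le> C * (?A * c ^ CARD('d))" by (simp add: mult_ac)
  have rate0: "?rate > 0" using N1 by auto
  have sep: "separated h ?K (grid_point q)" by (rule separated_grid) (rule h_def)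
  have ind01: "0 \<le> indicat_real U \<kappa> \<and> indicat_real U \<kappa> \<le> 1" for U :: "('d \<Rightarrow> nat) set" and \<kappa>
    by (auto simp: indicator_def)
  have A0: "?A \<ge> 0" using a by simp
  have M: "real ?M = real q ^ CARD('d)" by (simp add: card_grid)
  have hM: "h ^ CARD('d) * 2 ^ CARD('d) * real ?M = 1"
    unfolding M using hb(1) by (simp add: h_def flip: power_mult_distrib)
  have f_meas: "?f S \<in> borel_measurable borel" for S
    by (rule bump_field_borel_measurable[OF hb(3) finite_grid sep ind01 A0])
  show ?thesis
  proof (rule minimax_prob_bump_fields[where \<Lambda> = 1 and h = h and K = ?K and z = "grid_point q"
        and J = "Pow ?K" and \<theta> = indicator and M = "real ?M" and b = ?b and i\<^sub>0 = i\<^sub>0, OF mV])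
    fix g :: "real^'d \<Rightarrow> real^'d" assume [measurable]: "g \<in> borel_measurable borel"
    let ?S = "{S \<in> Pow ?K. \<not> ennreal ?rate \<le> ennreal C * lp_norm_cube p (\<lambda>z. norm (g z - ?f S z))}"
    have l1: "(\<integral>\<^sup>+z\<in>unit_cube. ennreal (norm (g z - ?f S z)) \<partial>lborel) \<le> ennreal (2 * (?rate / C))" if "S \<in> ?S" for S
    proof -
      note [measurable] = f_meas[of S]
      have "ennreal C * lp_norm_cube p (\<lambda>z. norm (g z - ?f S z)) < ennreal C * ennreal (?rate / C)"
        using that C0 rate0 by (auto simp flip: ennreal_mult)
      then have "lp_norm_cube p (\<lambda>z. norm (g z - ?f S z)) < ennreal (?rate / C)"
        by (meson linorder_not_less mult_left_mono zero_le)
      from l1_norm_le_lp_norm_cube[OF _ p _ this] show ?thesis using C0 rate0 by simp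
    qed
    have ham: "8 * card (sym_diff S S') \<le> ?M" if S: "S \<in> ?S" "S' \<in> ?S" for S S'
    proof -
      note [measurable] = f_meas[of S] f_meas[of S']
      have "ennreal (real (card (sym_diff S S')) * (?A * c ^ CARD('d) * h ^ CARD('d)))
          \<le> (\<integral>\<^sup>+z\<in>unit_cube. ennreal (norm (?f S z - ?f S' z)) \<partial>lborel)"
        using grid_point_bounds[of _ q] S
        by (intro bump_field_l1_separation[OF hb(3) finite_grid sep A0]) (auto simp: h_def)
      also have "\<dots> \<le> (\<integral>\<^sup>+z. ennreal (norm (g z - ?f S z)) * indicator unit_cube z
            + ennreal (norm (g z - ?f S' z)) * indicator unit_cube z \<partial>lborel)"
      proof (intro nn_integral_mono)
        fix z
        have "norm (?f S z - ?f S' z) \<le> norm (g z - ?f S z) + norm (g z - ?f S' z)"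
          by (metis dist_norm dist_triangle3)
        then show "ennreal (norm (?f S z - ?f S' z)) * indicator unit_cube z
           \<le> ennreal (norm (g z - ?f S z)) * indicator unit_cube z
            + ennreal (norm (g z - ?f S' z)) * indicator unit_cube z"
          by (auto simp: indicator_def simp flip: ennreal_plus)
      qed
      also have "\<dots> = (\<integral>\<^sup>+z\<in>unit_cube. ennreal (norm (g z - ?f S z)) \<partial>lborel)
          + (\<integral>\<^sup>+z\<in>unit_cube. ennreal (norm (g z - ?f S' z)) \<partial>lborel)"
        by (rule nn_integral_add) measurable
      also have "\<dots> \<le> ennreal (2 * (?rate / C)) + ennreal (2 * (?rate / C))"
        by (intro add_mono l1 S)
      also have "\<dots> = ennreal (4 * (?rate / C))" using C0 rate0 by (simp flip: ennreal_plus)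
      finally have le: "real (card (sym_diff S S')) * (?A * c ^ CARD('d) * h ^ CARD('d)) \<le> 4 * (?rate / C)"
        using C0 rate0 by simp
      let ?H = "real (card (sym_diff S S'))"
      have "?H * (?A * c ^ CARD('d) * h ^ CARD('d)) * (C * 2 ^ CARD('d) * real ?M)
          \<le> 4 * (?rate / C) * (C * 2 ^ CARD('d) * real ?M)"
        using C0 by (intro mult_right_mono le) auto
      then have "?H * (C * (?A * c ^ CARD('d))) * (h ^ CARD('d) * 2 ^ CARD('d) * real ?M)
          \<le> (4 * 2 ^ CARD('d) * ?rate) * real ?M"
        using C0 by (simp add: mult_ac)
      then have "?H * (C * (?A * c ^ CARD('d))) \<le> (4 * 2 ^ CARD('d) * ?rate) * real ?M"
        by (simp add: hM)
      moreover have "?H * (32 * 2 ^ CARD('d) * ?rate) \<le> ?H * (C * (?A * c ^ CARD('d)))"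
        by (intro mult_left_mono rate) simp
      moreover have "?H * (32 * 2 ^ CARD('d) * ?rate) = (4 * 2 ^ CARD('d) * ?rate) * (8 * ?H)" by simp
      ultimately have "(4 * 2 ^ CARD('d) * ?rate) * (8 * ?H) \<le> (4 * 2 ^ CARD('d) * ?rate) * real ?M"
        by linarith
      then have "8 * ?H \<le> real ?M" using rate0 by (subst (asm) mult_le_cancel_left_pos) auto
      then show ?thesis by linarith
    qed
    show "real (card ?S) \<le> ?b"
    proof (cases "?S = {}")
      case True
      show ?thesis unfolding True by simp
    next
      case False
      \<comment> \<open>The estimate is not itself a subset, so the Hamming ball is centred at one
        of the compatible hypotheses.\<close>
      then obtain S0 where S0: "S0 \<in> ?S" by blast
      have "card ?S \<le> card {S\<in>Pow ?K. 8 * card (sym_diff S S0) \<le> ?M}"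
        using ham[OF _ S0] by (intro card_mono) (auto simp: finite_grid)
      also have "real \<dots> \<le> ?b" using S0 by (intro card_hamming_ball finite_grid) auto
      finally show ?thesis by simp
    qed
  next
    show "real (card {\<kappa> \<in> ?K. indicat_real S \<kappa> \<noteq> 0}) \<le> real ?M" for S
      by (simp add: card_mono finite_grid)
    \<comment> \<open>The inequality M / 32 + 1 <= 3 M / 32 needs M >= 16, which comes from q >= exp
      4 >= 16.\<close>
    have "exp 4 \<le> N powr (1 / ?s)"
    proof -
      have "4 \<le> 1 / ?s * ln N" using N s by (simp add: field_simps)
      then show ?thesis using N(2) by (simp add: powr_def)
    qed
    moreover have "(16::real) \<le> exp 4"
    proof -
      have "(2::real) ^ 4 \<le> exp 1 ^ 4" using exp_ge_add_one_self[of 1] by (intro power_mono) auto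
      then show ?thesis by (simp flip: exp_of_nat_mult)
    qed
    ultimately have "16 \<le> real q" using hb(2) by linarith
    also have "real q \<le> real ?M"
      unfolding M using hb(1) power_increasing[of 1 "CARD('d)" "real q"] by simp
    finally have M16: "16 \<le> real ?M" .
    have "real ?M / (32 * ?s) \<le> real ?M / 32" using s by (intro divide_left_mono) auto
    then have "real ?M * 1 / (32 * ?s) + 1 \<le> real ?M / 32 + 1" by simp
    also have "\<dots> \<le> 3 / 4 * (real ?M / 8)" using M16 by simp
    also have "\<dots> \<le> 3 / 4 * ln (2 ^ ?M / ?b)" using hamming_ball_entropy[of ?M] by (intro mult_left_mono) auto
    finally show "real ?M * 1 / (32 * ?s) + 1 \<le> 3 / 4 * ln (real (card (Pow ?K)) / ?b)"
      by (simp add: card_Pow finite_grid)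
    show "h \<le> 1" using hb(4) by linarith
  qed (use hb sep in \<open>auto simp: finite_grid grid_point_in_unit_cube indicator_def\<close>)
qed

end

theorem theorem3p4:
  fixes \<beta> L\<^sub>\<beta> C\<^sub>n\<^sub>o\<^sub>i\<^sub>s\<^sub>e C\<^sub>c\<^sub>v\<^sub>r p :: real
    and L :: "nat \<Rightarrow> real"
  assumes "\<beta> \<ge> 1"
    and "\<forall>k\<le>smoothness_order \<beta>. L k > 0" and "L\<^sub>\<beta> > 0"
    and "C\<^sub>n\<^sub>o\<^sub>i\<^sub>s\<^sub>e > 0" and "C\<^sub>c\<^sub>v\<^sub>r > 0" and "p \<ge> 1"
  shows "\<exists>C>0. \<forall>m n T t (x :: nat \<Rightarrow> real^'d::finite) P.
    observation_design m n T t \<longrightarrow>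
    centered_distribution P \<longrightarrow>
    noise_condition C\<^sub>n\<^sub>o\<^sub>i\<^sub>s\<^sub>e P \<longrightarrow>
    cover_condition C\<^sub>c\<^sub>v\<^sub>r m x \<longrightarrow>
    (let d = real CARD('d);
         n_max = real (Max (n ` {1..m}));
         T_max = Max (T ` {1..m});
         N = real m * n_max * T_max\<^sup>2;
         F = (smooth_class \<beta> L L\<^sub>\<beta> :: (real^'d \<Rightarrow> real^'d) set)
     in real m powr (2 * \<beta> / d) \<ge> C * n_max * T_max\<^sup>2 \<longrightarrow>
        N \<ge> C \<longrightarrow>
        (\<forall>x\<^sub>0\<in>unit_cube.
           minimax_prob m n t x P F
             (\<lambda>g f. C * norm (g x\<^sub>0 - f x\<^sub>0) \<ge> N powr (- \<beta> / (2 * \<beta> + d))) \<ge> 1 / 4) \<and>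
        minimax_prob m n t x P F
          (\<lambda>g f. ennreal C * sup_loss g f \<ge> ennreal ((N / ln N) powr (- \<beta> / (2 * \<beta> + d)))) \<ge> 1 / 4 \<and>
        minimax_prob m n t x P F
          (\<lambda>g f. ennreal C * lp_norm_cube p (\<lambda>z. norm (g z - f z))
                   \<ge> ennreal (N powr (- \<beta> / (2 * \<beta> + d)))) \<ge> 1 / 4)"
proof -
  let ?d = "real CARD('d)" and ?l = "smoothness_order \<beta>"
  \<comment> \<open>The profile, \<open>a\<close> and \<open>C\<close> are fixed before any design
    or noise distribution is introduced; this yields the asserted uniformity of the
    constant.\<close>
  obtain \<psi> B c where profile: "bump_profile \<psi> ?l B c" using bump_profile_exists by blast
  interpret bump_profile \<psi> ?l B c by (rule profile)
  let ?D = "max 1 (C\<^sub>c\<^sub>v\<^sub>r * ?d ^ CARD('d))"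
  define Lm where "Lm = Min (L ` {..?l})"
  define b where "b = 2 * ?d ^ Suc ?l * B ^ CARD('d)"
  define r where "r = 32 * (2 * \<beta> + ?d) * (C\<^sub>n\<^sub>o\<^sub>i\<^sub>s\<^sub>e * ?D)"
  \<comment> \<open>The entry 1 gives a^2 <= a. The second entry meets all smoothness constants at
    once, since \<open>b\<close> dominates each factor multiplying \<open>a\<close> there. The entry
    \<open>1 / r\<close> makes the divergence small.\<close>
  define a where "a = min 1 (min (min Lm L\<^sub>\<beta> / b) (1 / r))"
  have Lm: "Lm > 0" "Lm \<le> L k" if "k \<le> ?l" for k
    using assms(2) that by (auto simp: Lm_def)
  have B0: "B ^ CARD('d) > 0" using B_ge_1 by simp
  have b: "b > 0" using B0 by (simp add: b_def)
  have r: "r > 0" using assms by (simp add: r_def)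
  have a: "a > 0" "a \<le> 1" using Lm(1)[of 0] \<open>L\<^sub>\<beta> > 0\<close> b r by (auto simp: a_def)
  have "a \<le> min Lm L\<^sub>\<beta> / b" "a \<le> 1 / r" by (auto simp: a_def)
  then have ab: "a * b \<le> min Lm L\<^sub>\<beta>" and ar: "a * r \<le> 1" using b r by (simp_all add: field_simps)
  have La: "?d ^ k * (a * B ^ CARD('d)) \<le> L k" if "k \<le> ?l" for k
  proof -
    have "?d ^ k \<le> ?d ^ Suc ?l" using that by (intro power_increasing) auto
    also have "\<dots> \<le> 2 * ?d ^ Suc ?l" by simp
    finally have "?d ^ k * (a * B ^ CARD('d)) \<le> 2 * ?d ^ Suc ?l * (a * B ^ CARD('d))"
      using a B0 by (intro mult_right_mono) auto
    also have "\<dots> = a * b" by (simp add: b_def mult_ac)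
    also have "\<dots> \<le> L k" using ab Lm(2)[OF that] by simp
    finally show ?thesis .
  qed
  have L\<beta>a: "2 * ?d ^ Suc ?l * (a * B ^ CARD('d)) \<le> L\<^sub>\<beta>" using ab by (simp add: b_def mult_ac)
  have a_small: "C\<^sub>n\<^sub>o\<^sub>i\<^sub>s\<^sub>e * a\<^sup>2 * ?D \<le> 1 / (32 * (2 * \<beta> + ?d))"
  proof -
    have "a\<^sup>2 \<le> a" using a by (simp add: power2_eq_square mult_left_le)
    then have "C\<^sub>n\<^sub>o\<^sub>i\<^sub>s\<^sub>e * ?D * (32 * (2 * \<beta> + ?d)) * a\<^sup>2 \<le> C\<^sub>n\<^sub>o\<^sub>i\<^sub>s\<^sub>e * ?D * (32 * (2 * \<beta> + ?d)) * a"
      using assms by (intro mult_left_mono) auto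
    also have "\<dots> = a * r" by (simp add: r_def mult_ac)
    also note ar
    finally have "C\<^sub>n\<^sub>o\<^sub>i\<^sub>s\<^sub>e * a\<^sup>2 * ?D * (32 * (2 * \<beta> + ?d)) \<le> 1" by (simp only: mult_ac)
    moreover have "32 * (2 * \<beta> + ?d) > 0" using assms by simp
    ultimately show ?thesis by (simp only: pos_le_divide_eq)
  qed
  \<comment> \<open>Entry by entry: 1 turns the assumption on m into V <= m^(2 \<beta> / d), the
    exponential gives ln N >= 4 (2 \<beta> + d), the third serves the pointwise and sup bounds, the
    last one the L^p bound.\<close>
  define C where "C = Max {1, exp (4 * (2 * \<beta> + ?d)), 128 * 4 powr \<beta> / a, 32 * 2 ^ CARD('d) * 4 powr \<beta> / (a * c ^ CARD('d))}"
  have "1 \<le> C" "exp (4 * (2 * \<beta> + ?d)) \<le> C" "128 * 4 powr \<beta> / a \<le> C"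
    "32 * 2 ^ CARD('d) * 4 powr \<beta> / (a * c ^ CARD('d)) \<le> C" by (auto simp: C_def)
  moreover have "a * c ^ CARD('d) > 0" using a c_pos by simp
  ultimately have C: "1 \<le> C" "exp (4 * (2 * \<beta> + ?d)) \<le> C" "128 * 4 powr \<beta> \<le> C * a"
    "32 * 2 ^ CARD('d) * 4 powr \<beta> \<le> C * a * c ^ CARD('d)"
    using a by (simp_all only: pos_divide_le_eq mult.assoc)
  show ?thesis
  proof (intro exI conjI allI impI)
    show "C > 0" using C(1) by simp
    fix m n T t and x :: "nat \<Rightarrow> real^'d" and P :: "(real^'d) measure"
    assume design: "observation_design m n T t" and P: "centered_distribution P"
      "noise_condition C\<^sub>n\<^sub>o\<^sub>i\<^sub>s\<^sub>e P" and cover: "cover_condition C\<^sub>c\<^sub>v\<^sub>r m x"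
    define V where "V = real (Max (n ` {1..m})) * (Max (T ` {1..m}))\<^sup>2"
    define N where "N = real m * V"
    define F :: "(real^'d \<Rightarrow> real^'d) set" where "F = smooth_class \<beta> L L\<^sub>\<beta>"
    interpret bump_experiment \<psi> ?l B c \<beta> a L\<^sub>\<beta> C\<^sub>n\<^sub>o\<^sub>i\<^sub>s\<^sub>e C\<^sub>c\<^sub>v\<^sub>r L m n T t x P ?d V N F
      by unfold_locales (use assms a La L\<beta>a a_small design P cover V_def N_def F_def in auto)
    have main: "(\<forall>x\<^sub>0\<in>unit_cube. 1 / 4 \<le> minimax_prob m n t x P F
             (\<lambda>g f. C * norm (g x\<^sub>0 - f x\<^sub>0) \<ge> N powr (- \<beta> / (2 * \<beta> + ?d)))) \<and>
        1 / 4 \<le> minimax_prob m n t x P F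
          (\<lambda>g f. ennreal C * sup_loss g f \<ge> ennreal ((N / ln N) powr (- \<beta> / (2 * \<beta> + ?d)))) \<and>
        1 / 4 \<le> minimax_prob m n t x P F
          (\<lambda>g f. ennreal C * lp_norm_cube p (\<lambda>z. norm (g z - f z)) \<ge> ennreal (N powr (- \<beta> / (2 * \<beta> + ?d))))"
      if CV: "real m powr (2 * \<beta> / ?d) \<ge> C * V" and NC: "N \<ge> C"
    proof -
      have "1 * V \<le> C * V" using C(1) V_pos by (intro mult_right_mono) auto
      then have mV: "real m powr (2 * \<beta> / ?d) \<ge> V" using CV by simp
      have N: "N \<ge> 1" "N > 0" "exp (4 * (2 * \<beta> + ?d)) \<le> N" using C NC by linarith+
      have lnN: "4 * (2 * \<beta> + ?d) \<le> ln N" using N by (simp add: ln_ge_iff)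
      show ?thesis
        using pointwise_lower_bound[OF mV N(1) _ C(3)] uniform_lower_bound[OF mV lnN N(2) C(3)]
          lp_lower_bound[OF mV lnN N(2) \<open>p \<ge> 1\<close> C(4)] by blast
    qed
    then show "let d = ?d; n_max = real (Max (n ` {1..m})); T_max = Max (T ` {1..m});
         N = real m * n_max * T_max\<^sup>2; F = (smooth_class \<beta> L L\<^sub>\<beta> :: (real^'d \<Rightarrow> real^'d) set)
     in real m powr (2 * \<beta> / d) \<ge> C * n_max * T_max\<^sup>2 \<longrightarrow>
        N \<ge> C \<longrightarrow>
        (\<forall>x\<^sub>0\<in>unit_cube.
           minimax_prob m n t x P F
             (\<lambda>g f. C * norm (g x\<^sub>0 - f x\<^sub>0) \<ge> N powr (- \<beta> / (2 * \<beta> + d))) \<ge> 1 / 4) \<and>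
        minimax_prob m n t x P F
          (\<lambda>g f. ennreal C * sup_loss g f \<ge> ennreal ((N / ln N) powr (- \<beta> / (2 * \<beta> + d)))) \<ge> 1 / 4 \<and>
        minimax_prob m n t x P F
          (\<lambda>g f. ennreal C * lp_norm_cube p (\<lambda>z. norm (g z - f z))
                   \<ge> ennreal (N powr (- \<beta> / (2 * \<beta> + d)))) \<ge> 1 / 4"
      unfolding Let_def mult.assoc[of "real m"] mult.assoc[of C] V_def[symmetric] N_def[symmetric] F_def[symmetric]
      by blast
  qed
qed

end
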